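(* Consider the scaled angular hierarchy for species $s$ and harmonics $m\ge1$, $$\delta^2\partial_Tf_{s,m}=-\tfrac{\delta}{2}\partial_X\big[v_s(f_{s,m-1}+f_{s,m+1})\big]+\delta^2D_t\partial_X^2f_{s,m}-\gamma_mf_{s,m},$$ together with $\delta^2\partial_T\rho_s=-\delta\,\partial_X(v_sf_{s,1})+\delta^2D_t\partial_X^2\rho_s$, $f_{s,0}=\rho_s$, with all $\gamma_m>0$ and with speeds $v_s=\sum_{a\ge0}\delta^{2a}v_{s,2a}[\rho]$. The formal expansion in $\delta$, in which the $f_{s,m}$ ($m\ge1$) are slaved to $\rho$, has the form $$f_{s,m}=\sum_{\substack{n\ge m\\ n-m\ \mathrm{even}}}\delta^nA_{s,m,n}[\rho],\qquad \partial_T\rho_s=\sum_{j\ge1}\delta^{2j-2}\mathcal F_{s,2j}[\rho],$$ where $A_{s,m,n}$ depends on the rates only through $\gamma_1,\dots,\gamma_{(n+m)/2}$, so that $\mathcal F_{s,2j}$ depends on the rates only through $\gamma_1,\dots,\gamma_j$. Therefore two turning generators (denoted $+$ and $-$) with $\gamma_{m,+}=\gamma_{m,-}=\gamma_m$ for $1\le m\le M$ have identical nonlinear closures through order $2M$, i.e. $\mathcal F^+_{s,2j}=\mathcal F^-_{s,2j}$ for all $j\le M$, and the first difference is $$\mathcal F^{+}_{s,2M+2}[\rho]-\mathcal F^{-}_{s,2M+2}[\rho]=\frac{\gamma_{M+1,+}^{-1}-\gamma_{M+1,-}^{-1}}{2^{2M+1}\prod_{j=1}^{M}\gamma_j^{2}}\,\mathcal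 D_s^{\,2M+2}\rho_s,\qquad \mathcal D_sg:=\partial_X\big[v_s^{(0)}(\rho)\,g\big],$$ where powers of $\mathcal D_s$ denote repeated application.
   Context: Setting: a kinetic model with several species $s$, $\partial_tF_s=-\partial_x(v_s\cos\theta F_s)+D_t\partial_x^2F_s+\alpha\int q(\varphi)[F_s(x,\theta-\varphi)-F_s(x,\theta)]d\varphi$, with even turning kernel $q$ common to the species, $F_s$ even in $\theta$, $f_{s,m}=\int F_s\cos(m\theta)\,d\theta/2\pi$, $\rho_s=f_{s,0}$, rates $\gamma_m=\alpha(1-\int q\cos m\varphi\,d\varphi)$. Long-wave scaling: $X=\delta x$, $T=\delta^2t$, with the density coordinate $f_{s,0}=\rho_s$ fixed (no $\delta$-corrections to it). The speeds are orientation-independent smooth functions $v_s(\tilde\rho)$ of the sensed densities $\tilde\rho_u$ of all species, where $\tilde\rho_u$ is obtained from $\rho_u$ by a translation-invariant sensing kernel whose Fourier symbol $\hat K(k)=1+\kappa_2k^2+\kappa_4k^4+\cdots$ is even; replacing $k$ by $-i\delta\partial_X$ and expanding gives $v_s=\sum_a\delta^{2a}v_{s,2a}[\rho]$, with $v_{s,2a}$ differential functions of the densities that do not depend on the turning kernel, and $v^{(0)}_s=v_{s,0}=v_s(\rho)$. The slow-time derivative of $A_{s,m,n}[\rho]$ is computed by the Fréchet derivative along $\partial_T\rho=\sum_j\delta^{2j-2}\mathcal F_{2j}$. All identities are in the formal algebra of differential expressions in $\rho$ (formal power series in $\delta$); no estimate for solutions of the PDEs is asserted. *)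

theory Defs
  imports
    "HOL-Analysis.Analysis"
    "HOL-Computational_Algebra.Formal_Power_Series"
    "HOL-Library.Function_Algebras"
begin

(* J u k is the jet coordinate standing for the k-th X-derivative of the density of species u. *)
type_synonym 's jet = "'s \<Rightarrow> nat \<Rightarrow> real"

(* Formal power series in delta; the coefficient ring is the pointwise ring of functions of jets. *)
type_synonym 's dseries = "('s jet \<Rightarrow> real) fps"

definition densities :: "'s jet \<Rightarrow> 's \<Rightarrow> real" where
  "densities J = (\<lambda>u. J u 0)"

definition rho :: "'s \<Rightarrow> 's jet \<Rightarrow> real" where
  "rho s J = densities J s"

(* Omega is the set of density values on which the speeds are defined (e.g. the positive orthant,
   or UNIV); the derivative coordinates are unrestricted. *)
definition jets_over :: "('s \<Rightarrow> real) set \<Rightarrow> 's jet set" where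
  "jets_over \<Omega> = {J. densities J \<in> \<Omega>}"

definition jet_slice :: "'s \<Rightarrow> nat \<Rightarrow> ('s jet \<Rightarrow> real) \<Rightarrow> 's jet \<Rightarrow> real \<Rightarrow> real" where
  "jet_slice u k f J = (\<lambda>t. f (J(u := (J u)(k := t))))"

definition jet_partial :: "'s \<Rightarrow> nat \<Rightarrow> ('s jet \<Rightarrow> real) \<Rightarrow> 's jet \<Rightarrow> real" where
  "jet_partial u k f J = deriv (jet_slice u k f J) (J u k)"

primrec iter_partial :: "('s \<times> nat) list \<Rightarrow> ('s jet \<Rightarrow> real) \<Rightarrow> 's jet \<Rightarrow> real" where
  "iter_partial [] f = f"
| "iter_partial (p # ps) f = jet_partial (fst p) (snd p) (iter_partial ps f)"

(* Dependence on finitely many jet coordinates, and C^infinity in them: all iterated partial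
   derivatives exist and are continuous.  Continuity refers to the product topology, which for
   functions of finitely many coordinates is ordinary joint continuity in those coordinates. *)
definition differential_function ::
    "('s::finite \<Rightarrow> real) set \<Rightarrow> ('s jet \<Rightarrow> real) \<Rightarrow> bool" where
  "differential_function \<Omega> f \<longleftrightarrow>
     (\<exists>N. \<forall>J\<in>jets_over \<Omega>. \<forall>J'\<in>jets_over \<Omega>.
        (\<forall>u. \<forall>k\<le>N. J u k = J' u k) \<longrightarrow> f J = f J') \<and>
     (\<forall>ps. continuous_on (jets_over \<Omega>) (iter_partial ps f) \<and>
        (\<forall>u k. \<forall>J\<in>jets_over \<Omega>. jet_slice u k (iter_partial ps f) J differentiable at (J u k)))"

(* For a differential function the sums over k below have only finitely many nonzero terms. *)
definition total_deriv :: "('s::finite jet \<Rightarrow> real) \<Rightarrow> 's jet \<Rightarrow> real" where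
  "total_deriv f J = (\<Sum>u\<in>UNIV. \<Sum>k. jet_partial u k f J * J u (Suc k))"

(* Frechet derivative of the differential function f in the direction Q = (Q u)_u, that is, the
   time derivative of f along the evolution (d/dT) rho_u = Q u. *)
definition frechet_along ::
    "('s::finite \<Rightarrow> 's jet \<Rightarrow> real) \<Rightarrow> ('s jet \<Rightarrow> real) \<Rightarrow> 's jet \<Rightarrow> real" where
  "frechet_along Q f J = (\<Sum>u\<in>UNIV. \<Sum>k. jet_partial u k f J * (total_deriv ^^ k) (Q u) J)"

definition series_const :: "real \<Rightarrow> 's dseries" where
  "series_const c = fps_const (\<lambda>_. c)"

definition series_dX :: "'s::finite dseries \<Rightarrow> 's dseries" where
  "series_dX f = Abs_fps (\<lambda>n. total_deriv (fps_nth f n))"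

(* P u is the series of (d/dT) rho_u; the Frechet derivative is linear in its direction, so the
   coefficient of delta^n is a convolution. *)
definition series_dT :: "('s::finite \<Rightarrow> 's dseries) \<Rightarrow> 's dseries \<Rightarrow> 's dseries" where
  "series_dT P f =
     Abs_fps (\<lambda>n J. \<Sum>i\<le>n. frechet_along (\<lambda>u. fps_nth (P u) (n - i)) (fps_nth f i) J)"

definition series_eq_on :: "('s \<Rightarrow> real) set \<Rightarrow> 's dseries \<Rightarrow> 's dseries \<Rightarrow> bool" where
  "series_eq_on \<Omega> f g \<longleftrightarrow> (\<forall>n. \<forall>J\<in>jets_over \<Omega>. fps_nth f n J = fps_nth g n J)"

(* v s a is the coefficient of delta^(2a) in the speed of species s. *)
definition speed_series :: "('s \<Rightarrow> nat \<Rightarrow> 's jet \<Rightarrow> real) \<Rightarrow> 's \<Rightarrow> 's dseries" where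
  "speed_series v s = Abs_fps (\<lambda>n. if even n then v s (n div 2) else 0)"

(* Formal solutions of the scaled angular hierarchy in which all harmonics are slaved to the
   densities: f s m is the series of the m-th harmonic of species s and P s that of (d/dT) rho_s.
   No parity or leading-order structure of the series is presupposed. *)
definition slaved_expansion ::
    "('s::finite \<Rightarrow> real) set \<Rightarrow> ('s \<Rightarrow> nat \<Rightarrow> 's jet \<Rightarrow> real) \<Rightarrow> real \<Rightarrow> (nat \<Rightarrow> real) \<Rightarrow>
     ('s \<Rightarrow> nat \<Rightarrow> 's dseries) \<Rightarrow> ('s \<Rightarrow> 's dseries) \<Rightarrow> bool" where
  "slaved_expansion \<Omega> v Dt \<gamma> f P \<longleftrightarrow>
     (\<forall>s m n. differential_function \<Omega> (fps_nth (f s m) n)) \<and>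
     (\<forall>s n. differential_function \<Omega> (fps_nth (P s) n)) \<and>
     (\<forall>s. f s 0 = fps_const (rho s)) \<and>
     (\<forall>s m. m \<ge> 1 \<longrightarrow> series_eq_on \<Omega>
        (fps_X ^ 2 * series_dT P (f s m))
        (- series_const (1 / 2) * fps_X *
             series_dX (speed_series v s * (f s (m - 1) + f s (m + 1)))
         + fps_X ^ 2 * series_const Dt * series_dX (series_dX (f s m))
         - series_const (\<gamma> m) * f s m)) \<and>
     (\<forall>s. series_eq_on \<Omega>
        (fps_X ^ 2 * P s)
        (- fps_X * series_dX (speed_series v s * f s 1)
         + fps_X ^ 2 * series_const Dt * series_dX (series_dX (f s 0))))"

(* V s is the leading-order speed as a function of the densities. *)
definition flux_deriv ::
    "('s::finite \<Rightarrow> ('s \<Rightarrow> real) \<Rightarrow> real) \<Rightarrow> 's \<Rightarrow> ('s jet \<Rightarrow> real) \<Rightarrow> 's jet \<Rightarrow> real" where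
  "flux_deriv V s g = total_deriv (\<lambda>J. V s (densities J) * g J)"

end

theory Submission
  imports Defs
begin

text \<open>
Solving each moment equation for its relaxation term exhibits the coefficient of \<open>\<delta>\<^sup>n\<close> in the harmonic
\<open>m \<ge> 1\<close> as \<open>inverse (\<gamma> m)\<close> times an expression in lower orders: minus half the flux derivative of the
harmonics \<open>m - 1\<close> and \<open>m + 1\<close> at orders at most \<open>n - 1\<close>, diffusion of order \<open>n - 2\<close>, and the slow-time derivative, in
which the rate of the density is itself expressed through the first harmonic. Slaved expansions
are thus the fixed points of a map that gains one order of \<open>\<delta>\<close> (\<open>hierarchy_map_contracts\<close>), so they exist and are
unique (\<open>slaved_fixpoint_exists\<close>, \<open>slaved_fixpoint_unique\<close>). For existence the iterates must stay
within the differential functions, which follows from the closure of that class under sums,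
products, total derivatives and Frechet derivatives.

The rest is bookkeeping of the pairs \<open>(m, n)\<close> visited by the recursion. A transport step lowers \<open>n\<close> by
an odd number, since the speed is a series in \<open>\<delta>\<^sup>2\<close>, and changes \<open>m\<close> by one, so the parity of \<open>n + m\<close> is preserved and
nothing appears below the diagonal \<open>n = m\<close> (\<open>slaved_fixpoint_parity\<close>). No step increases \<open>n + m\<close>, and a
pair \<open>(m, n)\<close> with \<open>m \<le> n\<close> contributes the factor \<open>inverse (\<gamma> m)\<close> with \<open>m \<le> (n + m) div 2\<close>; this
bounds the rates that can occur (\<open>slaved_fixpoint_rate_dependence\<close>).

The rate of order \<open>2 * M\<close> is governed by the pair \<open>(1, 2 * M + 1)\<close>, and \<open>\<gamma> (M + 1)\<close> can enter only if \<open>n + m\<close> stays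
constant until the diagonal is reached at \<open>(M + 1, M + 1)\<close>. There is exactly one such path: straight up to the harmonic
\<open>M + 1\<close> and straight back down to the density. It uses nothing but transport at leading speed, hence a pure power of the
flux operator, and it visits each harmonic \<open>j \<le> M\<close> twice and the harmonic \<open>M + 1\<close> once. That accounts for the
product of squared rates, the single difference of inverse rates, and the powers of 2 from the coupling
constants \<open>1 / 2\<close>. The two halves of the path are \<open>leading_coefficient\<close> and \<open>first_difference_moment\<close>.
\<close>

section \<open>Calculus of differential functions\<close>

definition jet_order_le :: "('s \<Rightarrow> real) set \<Rightarrow> nat \<Rightarrow> ('s jet \<Rightarrow> real) \<Rightarrow> bool" where
  "jet_order_le \<Omega> N f \<longleftrightarrow>
     (\<forall>J\<in>jets_over \<Omega>. \<forall>J'\<in>jets_over \<Omega>. (\<forall>u. \<forall>k\<le>N. J u k = J' u k) \<longrightarrow> f J = f J')"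

definition jet_tame :: "('s::finite \<Rightarrow> real) set \<Rightarrow> ('s jet \<Rightarrow> real) \<Rightarrow> bool" where
  "jet_tame \<Omega> f \<longleftrightarrow> continuous_on (jets_over \<Omega>) f \<and>
     (\<forall>u k. \<forall>J\<in>jets_over \<Omega>. jet_slice u k f J differentiable at (J u k))"

text \<open>Membership in \<open>differential_function\<close> is awkward to establish by induction over lists of partial
derivatives, because the list grows at its outer end while the Leibniz rule acts at the inner end.
This predicate peels off the innermost derivative instead, so that closure under sums
and products follows by induction on the number of derivatives, as for ordinary \<open>C\<^sup>n\<close> functions.\<close>
primrec jet_smooth :: "('s::finite \<Rightarrow> real) set \<Rightarrow> nat \<Rightarrow> ('s jet \<Rightarrow> real) \<Rightarrow> bool" where
  "jet_smooth \<Omega> 0 f \<longleftrightarrow> jet_tame \<Omega> f"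
| "jet_smooth \<Omega> (Suc n) f \<longleftrightarrow> jet_tame \<Omega> f \<and> (\<forall>u k. jet_smooth \<Omega> n (jet_partial u k f))"

lemma iter_partial_snoc: "iter_partial (ps @ [(u, k)]) f = iter_partial ps (jet_partial u k f)"
  by (induction ps) auto

lemma jet_smooth_iff:
  "jet_smooth \<Omega> n f \<longleftrightarrow> (\<forall>ps. length ps \<le> n \<longrightarrow> jet_tame \<Omega> (iter_partial ps f))"
proof (induction n arbitrary: f)
  case 0
  then show ?case by simp
next
  case (Suc n)
  have "(\<forall>ps. length ps \<le> Suc n \<longrightarrow> jet_tame \<Omega> (iter_partial ps f)) \<longleftrightarrow>
      jet_tame \<Omega> f \<and> (\<forall>u k ps. length ps \<le> n \<longrightarrow> jet_tame \<Omega> (iter_partial ps (jet_partial u k f)))"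
    (is "?L \<longleftrightarrow> ?R")
  proof
    assume L: ?L
    have "jet_tame \<Omega> (iter_partial ps (jet_partial u k f))" if "length ps \<le> n" for u k ps
      using L[rule_format, of "ps @ [(u, k)]"] that by (simp add: iter_partial_snoc)
    moreover have "jet_tame \<Omega> f"
      using L[rule_format, of "[]"] by simp
    ultimately show ?R by blast
  next
    assume R: ?R
    show ?L
    proof (intro allI impI)
      fix ps :: "('a \<times> nat) list"
      assume "length ps \<le> Suc n"
      then show "jet_tame \<Omega> (iter_partial ps f)"
        using R by (cases ps rule: rev_cases) (auto simp: iter_partial_snoc)
    qed
  qed
  then show ?case by (simp add: Suc.IH)
qed

text \<open>The bridge between the two descriptions of smoothness: every closure property is proved for
\<open>jet_smooth\<close> and transferred by this equivalence.\<close>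
lemma differential_function_iff:
  "differential_function \<Omega> f \<longleftrightarrow> (\<exists>N. jet_order_le \<Omega> N f) \<and> (\<forall>n. jet_smooth \<Omega> n f)"
proof -
  have "(\<forall>n. jet_smooth \<Omega> n f) \<longleftrightarrow> (\<forall>ps. jet_tame \<Omega> (iter_partial ps f))"
    unfolding jet_smooth_iff by blast
  then show ?thesis
    unfolding differential_function_def jet_order_le_def jet_tame_def by blast
qed

lemma has_derivative_jet_slice:
  assumes "jet_tame \<Omega> f" "J \<in> jets_over \<Omega>"
  shows "(jet_slice u k f J has_real_derivative jet_partial u k f J) (at (J u k))"
  using assms by (simp add: jet_tame_def jet_partial_def DERIV_deriv_iff_real_differentiable)

lemma jet_order_le_mono: "jet_order_le \<Omega> M f \<Longrightarrow> M \<le> N \<Longrightarrow> jet_order_le \<Omega> N f"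
  unfolding jet_order_le_def by (meson le_trans)

lemma jet_order_le_combine:
  assumes "jet_order_le \<Omega> N f" "jet_order_le \<Omega> N g"
  shows "jet_order_le \<Omega> N (\<lambda>J. h (f J) (g J))"
  unfolding jet_order_le_def
proof (intro ballI impI)
  fix J J'
  assume "J \<in> jets_over \<Omega>" "J' \<in> jets_over \<Omega>" "\<forall>u. \<forall>k\<le>N. J u k = J' u k"
  then have "f J = f J'" "g J = g J'"
    using assms unfolding jet_order_le_def by blast+
  then show "h (f J) (g J) = h (f J') (g J')" by simp
qed

lemma obtain_common_jet_order:
  assumes "differential_function \<Omega> f" "differential_function \<Omega> g"
  obtains N where "jet_order_le \<Omega> N f" "jet_order_le \<Omega> N g"
proof -
  obtain M N where "jet_order_le \<Omega> M f" "jet_order_le \<Omega> N g"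
    using assms unfolding differential_function_iff by blast
  then have "jet_order_le \<Omega> (max M N) f" "jet_order_le \<Omega> (max M N) g"
    by (auto intro: jet_order_le_mono)
  then show thesis by (rule that)
qed

lemma jet_smooth_tame: "jet_smooth \<Omega> n f \<Longrightarrow> jet_tame \<Omega> f"
  by (cases n) auto

lemma jet_smooth_Suc: "jet_smooth \<Omega> (Suc n) f \<Longrightarrow> jet_smooth \<Omega> n f"
  unfolding jet_smooth_iff by simp

lemma differential_function_tame: "differential_function \<Omega> f \<Longrightarrow> jet_tame \<Omega> f"
  unfolding differential_function_iff using jet_smooth_tame by blast

text \<open>Openness of the set of densities makes all differential operators local: a coordinate slice through a
jet over \<open>\<Omega>\<close> stays over \<open>\<Omega>\<close> for nearby parameter values, so values of a function off
\<open>jets_over \<Omega>\<close>, about which the hypotheses say nothing, never influence a derivative. All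
congruence rules below rest on this.\<close>
locale jet_domain =
  fixes \<Omega> :: "('s::finite \<Rightarrow> real) set"
  assumes open_dom: "open \<Omega>"
begin

lemma eventually_slice_in_jets_over:
  assumes J: "J \<in> jets_over \<Omega>"
  shows "\<forall>\<^sub>F t in nhds (J u k). J(u := (J u)(k := t)) \<in> jets_over \<Omega>"
proof -
  define c where "c = (\<lambda>t. densities (J(u := (J u)(k := t))))"
  have "continuous_on UNIV c"
  proof (rule continuous_on_coordinatewise_then_product)
    fix w
    have "(\<lambda>t. c t w) = (if w = u \<and> k = 0 then (\<lambda>t. t) else (\<lambda>t. J w 0))"
      by (auto simp: c_def densities_def)
    then show "continuous_on UNIV (\<lambda>t. c t w)"
      by (metis continuous_on_const continuous_on_id)
  qed
  then have "open (c -` \<Omega>)"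
    using open_dom by (simp add: open_vimage)
  moreover have "J u k \<in> c -` \<Omega>"
    using J by (simp add: c_def jets_over_def)
  ultimately have "\<forall>\<^sub>F t in nhds (J u k). t \<in> c -` \<Omega>"
    by (rule eventually_nhds_in_open)
  then show ?thesis
    by (simp add: c_def jets_over_def)
qed

lemma eventually_jet_slice_cong:
  assumes "J \<in> jets_over \<Omega>" "\<And>J. J \<in> jets_over \<Omega> \<Longrightarrow> f J = g J"
  shows "\<forall>\<^sub>F t in nhds (J u k). jet_slice u k f J t = jet_slice u k g J t"
  using eventually_slice_in_jets_over[OF assms(1), of u k]
  by eventually_elim (simp add: jet_slice_def assms(2))

lemma jet_partial_cong:
  assumes "J \<in> jets_over \<Omega>" "\<And>J. J \<in> jets_over \<Omega> \<Longrightarrow> f J = g J"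
  shows "jet_partial u k f J = jet_partial u k g J"
  unfolding jet_partial_def by (rule deriv_cong_ev[OF eventually_jet_slice_cong]) (use assms in auto)

lemma jet_tame_cong:
  assumes "\<And>J. J \<in> jets_over \<Omega> \<Longrightarrow> f J = g J"
  shows "jet_tame \<Omega> f \<longleftrightarrow> jet_tame \<Omega> g"
proof -
  have "jet_slice u k f J differentiable at (J u k) \<longleftrightarrow> jet_slice u k g J differentiable at (J u k)"
    if "J \<in> jets_over \<Omega>" for u k J
    using DERIV_cong_ev[OF refl eventually_jet_slice_cong[where f=f and g=g, OF that assms, of u k] refl]
    by (simp add: real_differentiable_def)
  moreover have "continuous_on (jets_over \<Omega>) f \<longleftrightarrow> continuous_on (jets_over \<Omega>) g"
    by (rule continuous_on_cong) (auto simp: assms)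
  ultimately show ?thesis
    by (simp add: jet_tame_def)
qed

lemma jet_smooth_cong:
  assumes "\<And>J. J \<in> jets_over \<Omega> \<Longrightarrow> f J = g J"
  shows "jet_smooth \<Omega> n f \<longleftrightarrow> jet_smooth \<Omega> n g"
  using assms
proof (induction n arbitrary: f g)
  case 0
  then show ?case using jet_tame_cong[of f g] by simp
next
  case (Suc n)
  have "jet_smooth \<Omega> n (jet_partial u k f) \<longleftrightarrow> jet_smooth \<Omega> n (jet_partial u k g)" for u k
    by (rule Suc.IH) (rule jet_partial_cong, auto simp: Suc.prems)
  then show ?case
    using jet_tame_cong[of f g] Suc.prems by simp
qed

lemma differential_function_cong:
  assumes "\<And>J. J \<in> jets_over \<Omega> \<Longrightarrow> f J = g J"
  shows "differential_function \<Omega> f \<longleftrightarrow> differential_function \<Omega> g"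
  unfolding differential_function_iff jet_order_le_def
  using assms jet_smooth_cong[of f g] by simp

lemma jet_tame_const: "jet_tame \<Omega> (\<lambda>_. c)"
  by (simp add: jet_tame_def jet_slice_def)

lemma jet_partial_const: "jet_partial u k (\<lambda>_. c) = (\<lambda>_. 0)"
  by (simp add: jet_partial_def jet_slice_def fun_eq_iff)

lemma jet_smooth_const: "jet_smooth \<Omega> n (\<lambda>_. c)"
  by (induction n arbitrary: c) (simp_all add: jet_tame_const jet_partial_const)

lemma jet_slice_coord: "jet_slice u k (\<lambda>J. J w l) J = (if w = u \<and> l = k then (\<lambda>t. t) else (\<lambda>_. J w l))"
  by (auto simp: jet_slice_def fun_eq_iff)

lemma jet_smooth_coord: "jet_smooth \<Omega> n (\<lambda>J. J w l)"
proof -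
  have "continuous_on (jets_over \<Omega>) (\<lambda>J::'s jet. J w l)"
    using continuous_on_product_then_coordinatewise[where f = "\<lambda>J::'s jet. J w",
        OF continuous_on_product_then_coordinatewise[where f = "\<lambda>J::'s jet. J", OF continuous_on_id]] .
  then have "jet_tame \<Omega> (\<lambda>J. J w l)"
    by (simp add: jet_tame_def jet_slice_coord)
  moreover have "jet_partial u k (\<lambda>J. J w l) = (\<lambda>_. if w = u \<and> l = k then 1 else 0)" for u k
    by (simp add: jet_partial_def jet_slice_coord fun_eq_iff)
  ultimately show ?thesis
    using jet_smooth_const by (cases n) simp_all
qed

lemma jet_tame_add:
  assumes "jet_tame \<Omega> f" "jet_tame \<Omega> g"
  shows "jet_tame \<Omega> (\<lambda>J. f J + g J)"
  using assms by (auto simp: jet_tame_def jet_slice_def intro!: continuous_intros differentiable_add)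

lemma jet_tame_mult:
  assumes "jet_tame \<Omega> f" "jet_tame \<Omega> g"
  shows "jet_tame \<Omega> (\<lambda>J. f J * g J)"
  using assms by (auto simp: jet_tame_def jet_slice_def intro!: continuous_intros differentiable_mult)

lemma jet_partial_add:
  assumes "jet_tame \<Omega> f" "jet_tame \<Omega> g" "J \<in> jets_over \<Omega>"
  shows "jet_partial u k (\<lambda>J. f J + g J) J = jet_partial u k f J + jet_partial u k g J"
  unfolding jet_partial_def[of u k "\<lambda>J. f J + g J"]
  using DERIV_add[OF assms(1,2)[THEN has_derivative_jet_slice, OF assms(3), of u k]]
  by (intro DERIV_imp_deriv) (simp add: jet_slice_def)

lemma jet_partial_mult:
  assumes "jet_tame \<Omega> f" "jet_tame \<Omega> g" "J \<in> jets_over \<Omega>"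
  shows "jet_partial u k (\<lambda>J. f J * g J) J = jet_partial u k f J * g J + jet_partial u k g J * f J"
  unfolding jet_partial_def[of u k "\<lambda>J. f J * g J"]
  using DERIV_mult[OF assms(1,2)[THEN has_derivative_jet_slice, OF assms(3), of u k]]
  by (intro DERIV_imp_deriv) (simp add: jet_slice_def)

lemma jet_smooth_add:
  "jet_smooth \<Omega> n f \<Longrightarrow> jet_smooth \<Omega> n g \<Longrightarrow> jet_smooth \<Omega> n (\<lambda>J. f J + g J)"
proof (induction n arbitrary: f g)
  case 0
  then show ?case by (simp add: jet_tame_add)
next
  case (Suc n)
  have "jet_smooth \<Omega> n (jet_partial u k (\<lambda>J. f J + g J)) \<longleftrightarrow>
      jet_smooth \<Omega> n (\<lambda>J. jet_partial u k f J + jet_partial u k g J)" for u k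
    by (rule jet_smooth_cong) (use Suc.prems in \<open>simp add: jet_partial_add\<close>)
  then show ?case
    using Suc by (simp add: jet_tame_add)
qed

text \<open>By the Leibniz rule a partial derivative of a product is again a sum of products of functions with one
derivative fewer to spare, so the induction closes together with \<open>jet_smooth_add\<close>.\<close>
lemma jet_smooth_mult:
  "jet_smooth \<Omega> n f \<Longrightarrow> jet_smooth \<Omega> n g \<Longrightarrow> jet_smooth \<Omega> n (\<lambda>J. f J * g J)"
proof (induction n arbitrary: f g)
  case 0
  then show ?case by (simp add: jet_tame_mult)
next
  case (Suc n)
  have "jet_smooth \<Omega> n (jet_partial u k (\<lambda>J. f J * g J)) \<longleftrightarrow>
      jet_smooth \<Omega> n (\<lambda>J. jet_partial u k f J * g J + jet_partial u k g J * f J)" for u k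
    by (rule jet_smooth_cong) (use Suc.prems in \<open>simp add: jet_partial_mult\<close>)
  moreover have "jet_smooth \<Omega> n (\<lambda>J. jet_partial u k f J * g J + jet_partial u k g J * f J)" for u k
    using Suc.prems Suc.prems[THEN jet_smooth_Suc] by (intro jet_smooth_add Suc.IH) simp_all
  ultimately show ?case
    using Suc.prems by (simp add: jet_tame_mult)
qed

lemma jet_partial_eq_0:
  assumes N: "jet_order_le \<Omega> N f" and J: "J \<in> jets_over \<Omega>" and k: "N < k"
  shows "jet_partial u k f J = 0"
proof -
  have "f (J(u := (J u)(k := t))) = f J" for t
  proof -
    have "densities (J(u := (J u)(k := t))) = densities J"
      using k by (auto simp: densities_def)
    then have "J(u := (J u)(k := t)) \<in> jets_over \<Omega>"
      using J by (simp add: jets_over_def)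
    moreover have "\<forall>w. \<forall>l\<le>N. (J(u := (J u)(k := t))) w l = J w l"
      using k by auto
    ultimately show ?thesis
      using N J unfolding jet_order_le_def by blast
  qed
  then have "jet_slice u k f J = (\<lambda>_. f J)"
    by (simp add: jet_slice_def)
  then show ?thesis by (simp add: jet_partial_def)
qed

text \<open>For coordinates of order at most \<open>N\<close> the two slices coincide near the common base point; for higher
coordinates both derivatives vanish.\<close>
lemma jet_order_le_partial:
  assumes N: "jet_order_le \<Omega> N f"
  shows "jet_order_le \<Omega> N (jet_partial u k f)"
  unfolding jet_order_le_def
proof (intro ballI impI)
  fix J J' assume J: "J \<in> jets_over \<Omega>" and J': "J' \<in> jets_over \<Omega>"
    and eq: "\<forall>u. \<forall>k\<le>N. J u k = J' u k"
  show "jet_partial u k f J = jet_partial u k f J'"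
  proof (cases "k \<le> N")
    case False
    then show ?thesis using jet_partial_eq_0[OF N] J J' by simp
  next
    case True
    then have Juk: "J u k = J' u k" using eq by simp
    have "\<forall>\<^sub>F t in nhds (J u k). jet_slice u k f J t = jet_slice u k f J' t"
      using eventually_slice_in_jets_over[OF J, of u k]
        eventually_slice_in_jets_over[OF J', of u k, folded Juk]
    proof eventually_elim
      case (elim t)
      have "\<forall>w. \<forall>l\<le>N. (J(u := (J u)(k := t))) w l = (J'(u := (J' u)(k := t))) w l"
        using eq by (simp only: fun_upd_apply) auto
      then show ?case
        using N elim unfolding jet_slice_def jet_order_le_def by blast
    qed
    then show ?thesis
      unfolding jet_partial_def by (rule deriv_cong_ev) (rule Juk)
  qed
qed

lemma differential_function_const: "differential_function \<Omega> (\<lambda>_. c)"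
  by (auto simp: differential_function_iff jet_order_le_def jet_smooth_const)

lemma differential_function_coord: "differential_function \<Omega> (\<lambda>J. J u k)"
  by (auto simp: differential_function_iff jet_order_le_def jet_smooth_coord)

lemma differential_function_add:
  assumes "differential_function \<Omega> f" "differential_function \<Omega> g"
  shows "differential_function \<Omega> (\<lambda>J. f J + g J)"
proof -
  obtain N where "jet_order_le \<Omega> N f" "jet_order_le \<Omega> N g"
    using assms by (rule obtain_common_jet_order)
  then have "jet_order_le \<Omega> N (\<lambda>J. f J + g J)"
    by (rule jet_order_le_combine)
  then show ?thesis
    using assms by (auto simp: differential_function_iff jet_smooth_add)
qed

lemma differential_function_mult:
  assumes "differential_function \<Omega> f" "differential_function \<Omega> g"
  shows "differential_function \<Omega> (\<lambda>J. f J * g J)"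
proof -
  obtain N where "jet_order_le \<Omega> N f" "jet_order_le \<Omega> N g"
    using assms by (rule obtain_common_jet_order)
  then have "jet_order_le \<Omega> N (\<lambda>J. f J * g J)"
    by (rule jet_order_le_combine)
  then show ?thesis
    using assms by (auto simp: differential_function_iff jet_smooth_mult)
qed

lemma differential_function_cmult:
  "differential_function \<Omega> f \<Longrightarrow> differential_function \<Omega> (\<lambda>J. c * f J)"
  by (intro differential_function_mult differential_function_const)

lemma differential_function_diff:
  assumes "differential_function \<Omega> f" "differential_function \<Omega> g"
  shows "differential_function \<Omega> (\<lambda>J. f J - g J)"
  using differential_function_add[OF assms(1) differential_function_cmult[OF assms(2), of "-1"]]
  by simp

lemma differential_function_sum:
  assumes "\<And>i. i \<in> A \<Longrightarrow> differential_function \<Omega> (f i)"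
  shows "differential_function \<Omega> (\<lambda>J. \<Sum>i\<in>A. f i J)"
  using assms
  by (induction A rule: infinite_finite_induct)
    (auto simp: differential_function_const intro: differential_function_add)

lemma differential_function_partial:
  "differential_function \<Omega> f \<Longrightarrow> differential_function \<Omega> (jet_partial u k f)"
  unfolding differential_function_iff using jet_order_le_partial jet_smooth.simps(2) by blast

text \<open>The infinite sums over jet orders are finite for functions of finite order. This is what gives the
total derivative and the Frechet derivative of a differential function a usable form.\<close>
lemma total_deriv_finite:
  assumes "jet_order_le \<Omega> N f" "J \<in> jets_over \<Omega>"
  shows "total_deriv f J = (\<Sum>u\<in>UNIV. \<Sum>k\<le>N. jet_partial u k f J * J u (Suc k))"
  unfolding total_deriv_def
  by (intro sum.cong refl suminf_finite) (auto simp: jet_partial_eq_0[OF assms])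

lemma frechet_along_finite:
  assumes "jet_order_le \<Omega> N f" "J \<in> jets_over \<Omega>"
  shows "frechet_along Q f J =
    (\<Sum>u\<in>UNIV. \<Sum>k\<le>N. jet_partial u k f J * (total_deriv ^^ k) (Q u) J)"
  unfolding frechet_along_def
  by (intro sum.cong refl suminf_finite) (auto simp: jet_partial_eq_0[OF assms])

lemma differential_function_total_deriv:
  assumes "differential_function \<Omega> f"
  shows "differential_function \<Omega> (total_deriv f)"
proof -
  obtain N where N: "jet_order_le \<Omega> N f"
    using assms by (auto simp: differential_function_iff)
  have "differential_function \<Omega> (\<lambda>J. \<Sum>u\<in>UNIV. \<Sum>k\<le>N. jet_partial u k f J * J u (Suc k))"
    by (intro differential_function_sum differential_function_mult differential_function_coord
        differential_function_partial assms)
  then show ?thesis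
    using differential_function_cong[OF total_deriv_finite[OF N]] by simp
qed

lemma differential_function_total_deriv_funpow:
  "differential_function \<Omega> f \<Longrightarrow> differential_function \<Omega> ((total_deriv ^^ k) f)"
  by (induction k) (auto intro: differential_function_total_deriv)

lemma differential_function_frechet_along:
  assumes "differential_function \<Omega> f" "\<And>u. differential_function \<Omega> (Q u)"
  shows "differential_function \<Omega> (frechet_along Q f)"
proof -
  obtain N where N: "jet_order_le \<Omega> N f"
    using assms by (auto simp: differential_function_iff)
  have "differential_function \<Omega>
      (\<lambda>J. \<Sum>u\<in>UNIV. \<Sum>k\<le>N. jet_partial u k f J * (total_deriv ^^ k) (Q u) J)"
    by (intro differential_function_sum differential_function_mult
        differential_function_total_deriv_funpow differential_function_partial assms)
  then show ?thesis
    using differential_function_cong[OF frechet_along_finite[OF N]] by simp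
qed

lemma total_deriv_cong:
  assumes "\<And>J. J \<in> jets_over \<Omega> \<Longrightarrow> f J = g J" "J \<in> jets_over \<Omega>"
  shows "total_deriv f J = total_deriv g J"
  unfolding total_deriv_def using jet_partial_cong[OF assms(2,1)] by simp

lemma total_deriv_funpow_cong:
  assumes "\<And>J. J \<in> jets_over \<Omega> \<Longrightarrow> f J = g J" "J \<in> jets_over \<Omega>"
  shows "(total_deriv ^^ k) f J = (total_deriv ^^ k) g J"
  using assms(2) by (induction k arbitrary: J) (auto simp: assms(1) intro: total_deriv_cong)

lemma frechet_along_cong:
  assumes "\<And>u J. J \<in> jets_over \<Omega> \<Longrightarrow> P u J = Q u J"
    and "\<And>J. J \<in> jets_over \<Omega> \<Longrightarrow> f J = g J" "J \<in> jets_over \<Omega>"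
  shows "frechet_along P f J = frechet_along Q g J"
  unfolding frechet_along_def
  using jet_partial_cong[OF assms(3,2)] total_deriv_funpow_cong[OF assms(1,3)] by simp

lemma total_deriv_0: "total_deriv (\<lambda>_. 0) = (\<lambda>_. 0)"
  by (simp add: total_deriv_def jet_partial_const fun_eq_iff)

lemma total_deriv_funpow_0: "(total_deriv ^^ k) (\<lambda>_. 0) = (\<lambda>_. 0)"
  by (induction k) (simp_all add: total_deriv_0)

lemma frechet_along_eq_0:
  assumes "(\<forall>J\<in>jets_over \<Omega>. f J = 0) \<or> (\<forall>u. \<forall>J\<in>jets_over \<Omega>. Q u J = 0)" "J \<in> jets_over \<Omega>"
  shows "frechet_along Q f J = 0"
  using assms(1)
proof
  assume "\<forall>J\<in>jets_over \<Omega>. f J = 0"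
  then have "frechet_along Q f J = frechet_along Q (\<lambda>_. 0) J"
    using assms(2) by (intro frechet_along_cong) auto
  then show ?thesis by (simp add: frechet_along_def jet_partial_const)
next
  assume "\<forall>u. \<forall>J\<in>jets_over \<Omega>. Q u J = 0"
  then have "frechet_along Q f J = frechet_along (\<lambda>_ _. 0) f J"
    using assms(2) by (intro frechet_along_cong) auto
  then show ?thesis by (simp add: frechet_along_def total_deriv_funpow_0)
qed

lemma total_deriv_add:
  assumes f: "differential_function \<Omega> f" and g: "differential_function \<Omega> g"
    and J: "J \<in> jets_over \<Omega>"
  shows "total_deriv (\<lambda>J. f J + g J) J = total_deriv f J + total_deriv g J"
proof -
  obtain N where M: "jet_order_le \<Omega> N f" and N: "jet_order_le \<Omega> N g"
    using f g by (rule obtain_common_jet_order)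
  have MN: "jet_order_le \<Omega> N (\<lambda>J. f J + g J)"
    using M N by (rule jet_order_le_combine)
  show ?thesis
    unfolding total_deriv_finite[OF M J] total_deriv_finite[OF N J] total_deriv_finite[OF MN J]
    by (simp add: jet_partial_add[OF f[THEN differential_function_tame] g[THEN differential_function_tame] J] distrib_right sum.distrib)
qed

lemma total_deriv_cmult:
  assumes f: "differential_function \<Omega> f" and J: "J \<in> jets_over \<Omega>"
  shows "total_deriv (\<lambda>J. c * f J) J = c * total_deriv f J"
proof -
  obtain N where N: "jet_order_le \<Omega> N f"
    using f unfolding differential_function_iff by blast
  have N': "jet_order_le \<Omega> N (\<lambda>J. c * f J)"
    using N N by (rule jet_order_le_combine)
  show ?thesis
    unfolding total_deriv_finite[OF N J] total_deriv_finite[OF N' J]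
    by (simp add: jet_partial_mult[OF jet_tame_const f[THEN differential_function_tame] J]
        jet_partial_const sum_distrib_left mult_ac)
qed

lemma total_deriv_diff:
  assumes f: "differential_function \<Omega> f" and g: "differential_function \<Omega> g"
    and J: "J \<in> jets_over \<Omega>"
  shows "total_deriv (\<lambda>J. f J - g J) J = total_deriv f J - total_deriv g J"
  using total_deriv_add[OF f differential_function_cmult[OF g, of "-1"] J] total_deriv_cmult[OF g J, of "-1"]
  by simp

end

section \<open>The hierarchy as a fixed-point equation\<close>

lemma fps_mult_nth_apply:
  fixes f g :: "('a \<Rightarrow> real) fps"
  shows "fps_nth (f * g) n J = (\<Sum>i\<le>n. fps_nth f i J * fps_nth g (n - i) J)"
proof -
  have "sum h A J = (\<Sum>i\<in>A. h i J)" for h :: "nat \<Rightarrow> 'a \<Rightarrow> real" and A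
    by (induction A rule: infinite_finite_induct) auto
  then show ?thesis
    by (simp add: fps_mult_nth atLeast0AtMost)
qed

lemma series_const_mult_nth: "fps_nth (series_const c * F) n J = c * fps_nth F n J"
  by (simp add: series_const_def)

lemma series_const_1: "series_const 1 = 1"
  by (simp add: series_const_def flip: one_fun_def)

lemma moment_rhs_nth:
  "fps_nth (- series_const a * fps_X * A + fps_X ^ 2 * series_const b * B) n J =
     (if n = 0 then 0 else - a * fps_nth A (n - 1) J)
     + (if n < 2 then 0 else b * fps_nth B (n - 2) J)"
proof -
  have eq: "- series_const a * fps_X * A + fps_X ^ 2 * series_const b * B =
      - (series_const a * (fps_X * A)) + series_const b * (fps_X ^ 2 * B)"
    by (simp add: mult_ac)
  show ?thesis
    unfolding eq by (simp add: series_const_mult_nth fps_X_power_mult_nth)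
qed

text \<open>The density equation solved for the slow-time derivative. Its coefficient of \<open>\<delta>\<^sup>n\<close> involves the
first harmonic up to order \<open>n + 1\<close>, because one power of \<open>\<delta>\<close> is divided out.\<close>
definition closed_rate ::
    "('s::finite \<Rightarrow> nat \<Rightarrow> 's jet \<Rightarrow> real) \<Rightarrow> real \<Rightarrow> ('s \<Rightarrow> nat \<Rightarrow> 's dseries) \<Rightarrow> 's \<Rightarrow> 's dseries" where
  "closed_rate v Dt f s =
     fps_shift 1 (- series_dX (speed_series v s * f s 1))
     + series_const Dt * series_dX (series_dX (f s 0))"

text \<open>The moment equations with the relaxation term solved for, and with the slow-time derivative
eliminated through \<open>closed_rate\<close>. Slaved expansions are the fixed points of this map over \<open>\<Omega>\<close>;
the harmonic of index 0 is reset to the density in order to make it a fixed-point condition as well.\<close>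
definition hierarchy_map ::
    "('s::finite \<Rightarrow> nat \<Rightarrow> 's jet \<Rightarrow> real) \<Rightarrow> real \<Rightarrow> (nat \<Rightarrow> real) \<Rightarrow>
     ('s \<Rightarrow> nat \<Rightarrow> 's dseries) \<Rightarrow> 's \<Rightarrow> nat \<Rightarrow> 's dseries" where
  "hierarchy_map v Dt \<gamma> f s m =
     (if m = 0 then fps_const (rho s)
      else series_const (inverse (\<gamma> m)) *
        (- series_const (1 / 2) * fps_X *
             series_dX (speed_series v s * (f s (m - 1) + f s (m + 1)))
         + fps_X ^ 2 * series_const Dt * series_dX (series_dX (f s m))
         - fps_X ^ 2 * series_dT (closed_rate v Dt f) (f s m)))"

lemma closed_rate_nth:
  "fps_nth (closed_rate v Dt f s) n J =
     - total_deriv (fps_nth (speed_series v s * f s 1) (Suc n)) J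
     + Dt * total_deriv (total_deriv (fps_nth (f s 0) n)) J"
  by (simp add: closed_rate_def series_dX_def series_const_def)

lemma hierarchy_map_nth:
  assumes "m \<noteq> 0"
  shows "fps_nth (hierarchy_map v Dt \<gamma> f s m) n J = inverse (\<gamma> m) *
     ((if n = 0 then 0
       else - (1 / 2) * total_deriv (fps_nth (speed_series v s * (f s (m - 1) + f s (m + 1))) (n - 1)) J)
      + (if n < 2 then 0
         else Dt * total_deriv (total_deriv (fps_nth (f s m) (n - 2))) J
           - (\<Sum>i\<le>n - 2. frechet_along (\<lambda>u. fps_nth (closed_rate v Dt f u) (n - 2 - i))
                 (fps_nth (f s m) i) J)))"
proof -
  show ?thesis
    using assms
    by (simp only: hierarchy_map_def if_False series_const_mult_nth fps_sub_nth minus_apply moment_rhs_nth)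
      (simp add: fps_X_power_mult_nth series_dX_def series_dT_def)
qed

locale angular_hierarchy = jet_domain \<Omega> for \<Omega> :: "('s::finite \<Rightarrow> real) set" +
  fixes v :: "'s \<Rightarrow> nat \<Rightarrow> 's jet \<Rightarrow> real" and Dt :: real
  assumes speed_differential: "differential_function \<Omega> (v s a)"
begin

abbreviation eq_jets :: "('s jet \<Rightarrow> real) \<Rightarrow> ('s jet \<Rightarrow> real) \<Rightarrow> bool" (infix "\<doteq>" 50) where
  "f \<doteq> g \<equiv> \<forall>J\<in>jets_over \<Omega>. f J = g J"

lemma speed_coeff_odd: "odd n \<Longrightarrow> fps_nth (speed_series v s) n J = 0"
  by (simp add: speed_series_def)

lemma differential_speed_mult:
  assumes "\<And>n. differential_function \<Omega> (fps_nth g n)"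
  shows "differential_function \<Omega> (fps_nth (speed_series v s * g) n)"
proof -
  have "differential_function \<Omega> (fps_nth (speed_series v s) i)" for i
    using speed_differential differential_function_const[of 0]
    by (simp add: speed_series_def zero_fun_def)
  then have "differential_function \<Omega> (\<lambda>J. \<Sum>i\<le>n. fps_nth (speed_series v s) i J * fps_nth g (n - i) J)"
    by (intro differential_function_sum differential_function_mult assms)
  then show ?thesis
    by (simp add: fps_mult_nth_apply[abs_def])
qed

text \<open>The speed is a series in \<open>\<delta>\<^sup>2\<close>, so multiplication by it only couples orders of the same parity. This is
the source of the parity structure of the expansion.\<close>
lemma speed_mult_cong:
  assumes "\<And>i. i \<le> n \<Longrightarrow> even (n - i) \<Longrightarrow> fps_nth g i \<doteq> fps_nth h i"
  shows "fps_nth (speed_series v s * g) n \<doteq> fps_nth (speed_series v s * h) n"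
proof
  fix J assume J: "J \<in> jets_over \<Omega>"
  have "fps_nth (speed_series v s) i J * fps_nth g (n - i) J =
      fps_nth (speed_series v s) i J * fps_nth h (n - i) J" if "i \<le> n" for i
    using assms[of "n - i"] J that by (cases "even i") (auto simp: speed_coeff_odd)
  then show "fps_nth (speed_series v s * g) n J = fps_nth (speed_series v s * h) n J"
    unfolding fps_mult_nth_apply by (intro sum.cong refl) simp
qed

text \<open>When two series differ only from order \<open>n\<close> on, the product with the speed sees at order \<open>n\<close> only the
leading speed. For this reason the first difference of two closures is free of the higher speed
corrections.\<close>
lemma speed_mult_diff_top:
  assumes "\<And>i. i < n \<Longrightarrow> even (n - i) \<Longrightarrow> fps_nth g i \<doteq> fps_nth h i" "J \<in> jets_over \<Omega>"
  shows "fps_nth (speed_series v s * g) n J - fps_nth (speed_series v s * h) n J =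
    v s 0 J * (fps_nth g n J - fps_nth h n J)"
proof -
  have "fps_nth (speed_series v s) i J * fps_nth g (n - i) J -
      fps_nth (speed_series v s) i J * fps_nth h (n - i) J =
      (if i = 0 then v s 0 J * (fps_nth g n J - fps_nth h n J) else 0)" if "i \<le> n" for i
    using assms(1)[of "n - i"] assms(2) that
    by (cases "even i") (auto simp: speed_coeff_odd speed_series_def algebra_simps)
  then show ?thesis
    by (simp add: fps_mult_nth_apply flip: sum_subtractf)
qed

lemma flux_cong:
  assumes "\<And>i. i \<le> n \<Longrightarrow> even (n - i) \<Longrightarrow> fps_nth g i \<doteq> fps_nth h i"
  shows "total_deriv (fps_nth (speed_series v s * g) n) \<doteq> total_deriv (fps_nth (speed_series v s * h) n)"
  using speed_mult_cong[OF assms] by (auto intro: total_deriv_cong)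

lemma flux_diff_top:
  assumes "\<And>n. differential_function \<Omega> (fps_nth g n)" "\<And>n. differential_function \<Omega> (fps_nth h n)"
    and "\<And>i. i < n \<Longrightarrow> even (n - i) \<Longrightarrow> fps_nth g i \<doteq> fps_nth h i" "J \<in> jets_over \<Omega>"
  shows "total_deriv (fps_nth (speed_series v s * g) n) J - total_deriv (fps_nth (speed_series v s * h) n) J =
    total_deriv (\<lambda>J. v s 0 J * (fps_nth g n J - fps_nth h n J)) J"
proof -
  have "total_deriv (\<lambda>J. v s 0 J * (fps_nth g n J - fps_nth h n J)) J =
      total_deriv (\<lambda>J. fps_nth (speed_series v s * g) n J - fps_nth (speed_series v s * h) n J) J"
    by (rule total_deriv_cong[OF _ assms(4)], rule speed_mult_diff_top[symmetric]) (use assms in auto)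
  then show ?thesis
    by (simp add: total_deriv_diff[OF differential_speed_mult[OF assms(1)]
          differential_speed_mult[OF assms(2)] assms(4)])
qed

lemma total_deriv2_cong:
  assumes "f \<doteq> g" shows "total_deriv (total_deriv f) \<doteq> total_deriv (total_deriv g)"
  using assms by (auto intro!: total_deriv_cong)

lemma closed_rate_cong:
  assumes "\<And>i. i \<le> Suc n \<Longrightarrow> even (Suc n - i) \<Longrightarrow> fps_nth (f s 1) i \<doteq> fps_nth (g s 1) i"
    and "fps_nth (f s 0) n \<doteq> fps_nth (g s 0) n"
  shows "fps_nth (closed_rate v Dt f s) n \<doteq> fps_nth (closed_rate v Dt g s) n"
proof -
  have "total_deriv (fps_nth (speed_series v s * f s 1) (Suc n)) \<doteq>
      total_deriv (fps_nth (speed_series v s * g s 1) (Suc n))"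
    by (rule flux_cong) (rule assms(1))
  then show ?thesis
    using total_deriv2_cong[OF assms(2)] by (simp add: closed_rate_nth)
qed

text \<open>A list of everything that an order \<open>n\<close> coefficient of \<open>hierarchy_map\<close> depends on. Contraction, parity and the
dependence on the rates are all read off from it; equality of the Frechet terms is left as a hypothesis
since it holds for a different reason in each case.\<close>
lemma hierarchy_map_cong:
  assumes "m \<noteq> 0" "\<gamma> m = \<gamma>' m"
    and "\<And>i. i < n \<Longrightarrow> even (n - 1 - i) \<Longrightarrow> fps_nth (f s (m - 1)) i \<doteq> fps_nth (g s (m - 1)) i"
    and "\<And>i. i < n \<Longrightarrow> even (n - 1 - i) \<Longrightarrow> fps_nth (f s (m + 1)) i \<doteq> fps_nth (g s (m + 1)) i"
    and "2 \<le> n \<Longrightarrow> fps_nth (f s m) (n - 2) \<doteq> fps_nth (g s m) (n - 2)"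
    and "\<And>i. i + 2 \<le> n \<Longrightarrow>
      frechet_along (\<lambda>u. fps_nth (closed_rate v Dt f u) (n - 2 - i)) (fps_nth (f s m) i) \<doteq>
      frechet_along (\<lambda>u. fps_nth (closed_rate v Dt g u) (n - 2 - i)) (fps_nth (g s m) i)"
  shows "fps_nth (hierarchy_map v Dt \<gamma> f s m) n \<doteq> fps_nth (hierarchy_map v Dt \<gamma>' g s m) n"
proof
  fix J assume J: "J \<in> jets_over \<Omega>"
  have "total_deriv (fps_nth (speed_series v s * (f s (m - 1) + f s (m + 1))) (n - 1)) J =
      total_deriv (fps_nth (speed_series v s * (g s (m - 1) + g s (m + 1))) (n - 1)) J" if "n \<noteq> 0"
    by (rule flux_cong[rule_format, OF _ J]) (use assms(3,4) that in auto)
  moreover have "total_deriv (total_deriv (fps_nth (f s m) (n - 2))) J =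
      total_deriv (total_deriv (fps_nth (g s m) (n - 2))) J" if "2 \<le> n"
    using total_deriv2_cong[OF assms(5)[OF that]] J by blast
  moreover have "(\<Sum>i\<le>n - 2. frechet_along (\<lambda>u. fps_nth (closed_rate v Dt f u) (n - 2 - i)) (fps_nth (f s m) i) J) =
      (\<Sum>i\<le>n - 2. frechet_along (\<lambda>u. fps_nth (closed_rate v Dt g u) (n - 2 - i)) (fps_nth (g s m) i) J)"
    if "2 \<le> n"
    by (rule sum.cong) (use assms(6) J that in auto)
  ultimately show "fps_nth (hierarchy_map v Dt \<gamma> f s m) n J = fps_nth (hierarchy_map v Dt \<gamma>' g s m) n J"
    unfolding hierarchy_map_nth[OF assms(1)] assms(2) by (cases "n = 0"; cases "2 \<le> n") simp_all
qed

text \<open>If everything but the order \<open>n - 1\<close> coefficients of the neighbouring harmonics agrees, the difference at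
order \<open>n\<close> is produced by transport at leading speed. Comparing with the zero family gives the
recursion for the leading coefficients, and comparing two slaved families gives the recursion for
their first difference.\<close>
lemma hierarchy_map_diff_top:
  assumes "m \<noteq> 0" "\<gamma> m = \<gamma>' m" "n \<noteq> 0"
    and "\<And>s m n. differential_function \<Omega> (fps_nth (f s m) n)"
    and "\<And>s m n. differential_function \<Omega> (fps_nth (g s m) n)"
    and "\<And>i. i < n - 1 \<Longrightarrow> even (n - 1 - i) \<Longrightarrow> fps_nth (f s (m - 1)) i \<doteq> fps_nth (g s (m - 1)) i"
    and "\<And>i. i < n - 1 \<Longrightarrow> even (n - 1 - i) \<Longrightarrow> fps_nth (f s (m + 1)) i \<doteq> fps_nth (g s (m + 1)) i"
    and "2 \<le> n \<Longrightarrow> fps_nth (f s m) (n - 2) \<doteq> fps_nth (g s m) (n - 2)"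
    and "\<And>i. i + 2 \<le> n \<Longrightarrow>
      frechet_along (\<lambda>u. fps_nth (closed_rate v Dt f u) (n - 2 - i)) (fps_nth (f s m) i) \<doteq>
      frechet_along (\<lambda>u. fps_nth (closed_rate v Dt g u) (n - 2 - i)) (fps_nth (g s m) i)"
    and J: "J \<in> jets_over \<Omega>"
  shows "fps_nth (hierarchy_map v Dt \<gamma> f s m) n J - fps_nth (hierarchy_map v Dt \<gamma>' g s m) n J =
    - (inverse (\<gamma> m) / 2) * total_deriv (\<lambda>J. v s 0 J *
        ((fps_nth (f s (m - 1)) (n - 1) J - fps_nth (g s (m - 1)) (n - 1) J) +
         (fps_nth (f s (m + 1)) (n - 1) J - fps_nth (g s (m + 1)) (n - 1) J))) J"
proof -
  have dsum: "differential_function \<Omega> (fps_nth (f s (m - 1) + f s (m + 1)) n)"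
    if "\<And>s m n. differential_function \<Omega> (fps_nth (f s m) n)" for f :: "'s \<Rightarrow> nat \<Rightarrow> 's dseries" and n
    using differential_function_add[OF that that] by (simp add: plus_fun_def)
  have "total_deriv (fps_nth (speed_series v s * (f s (m - 1) + f s (m + 1))) (n - 1)) J -
      total_deriv (fps_nth (speed_series v s * (g s (m - 1) + g s (m + 1))) (n - 1)) J =
      total_deriv (\<lambda>J. v s 0 J *
        (fps_nth (f s (m - 1) + f s (m + 1)) (n - 1) J - fps_nth (g s (m - 1) + g s (m + 1)) (n - 1) J)) J"
    by (rule flux_diff_top[OF dsum dsum _ J]) (use assms(4-7) in auto)
  then have flux: "total_deriv (fps_nth (speed_series v s * (f s (m - 1) + f s (m + 1))) (n - 1)) J =
      total_deriv (fps_nth (speed_series v s * (g s (m - 1) + g s (m + 1))) (n - 1)) J +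
      total_deriv (\<lambda>J. v s 0 J *
        ((fps_nth (f s (m - 1)) (n - 1) J - fps_nth (g s (m - 1)) (n - 1) J) +
         (fps_nth (f s (m + 1)) (n - 1) J - fps_nth (g s (m + 1)) (n - 1) J))) J"
    by (simp add: algebra_simps)
  have diffusion: "total_deriv (total_deriv (fps_nth (f s m) (n - 2))) J =
      total_deriv (total_deriv (fps_nth (g s m) (n - 2))) J" if "2 \<le> n"
    using total_deriv2_cong[OF assms(8)[OF that]] J by blast
  have drift: "(\<Sum>i\<le>n - 2. frechet_along (\<lambda>u. fps_nth (closed_rate v Dt f u) (n - 2 - i)) (fps_nth (f s m) i) J) =
      (\<Sum>i\<le>n - 2. frechet_along (\<lambda>u. fps_nth (closed_rate v Dt g u) (n - 2 - i)) (fps_nth (g s m) i) J)"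
    if "2 \<le> n"
    by (rule sum.cong) (use assms(9) J that in auto)
  show ?thesis
    unfolding hierarchy_map_nth[OF assms(1)] flux assms(2)
    using diffusion drift assms(3) by (cases "2 \<le> n") (simp_all add: algebra_simps)
qed

lemma closed_rate_diff_top:
  assumes "\<And>s m n. differential_function \<Omega> (fps_nth (f s m) n)"
    and "\<And>s m n. differential_function \<Omega> (fps_nth (g s m) n)"
    and "\<And>i. i \<le> n \<Longrightarrow> even (Suc n - i) \<Longrightarrow> fps_nth (f s 1) i \<doteq> fps_nth (g s 1) i"
    and "fps_nth (f s 0) n \<doteq> fps_nth (g s 0) n" and J: "J \<in> jets_over \<Omega>"
  shows "fps_nth (closed_rate v Dt f s) n J - fps_nth (closed_rate v Dt g s) n J =
    - total_deriv (\<lambda>J. v s 0 J * (fps_nth (f s 1) (Suc n) J - fps_nth (g s 1) (Suc n) J)) J"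
proof -
  have "total_deriv (fps_nth (speed_series v s * f s 1) (Suc n)) J -
      total_deriv (fps_nth (speed_series v s * g s 1) (Suc n)) J =
      total_deriv (\<lambda>J. v s 0 J * (fps_nth (f s 1) (Suc n) J - fps_nth (g s 1) (Suc n) J)) J"
    by (rule flux_diff_top[OF assms(1,2) _ J]) (use assms(3) in auto)
  moreover have "total_deriv (total_deriv (fps_nth (f s 0) n)) J = total_deriv (total_deriv (fps_nth (g s 0) n)) J"
    using total_deriv2_cong[OF assms(4)] J by blast
  ultimately show ?thesis
    by (simp add: closed_rate_nth)
qed

lemma differential_closed_rate:
  assumes "\<And>s m n. differential_function \<Omega> (fps_nth (f s m) n)"
  shows "differential_function \<Omega> (fps_nth (closed_rate v Dt f s) n)"
proof -
  have "differential_function \<Omega> (\<lambda>J. (- 1) * total_deriv (fps_nth (speed_series v s * f s 1) (Suc n)) J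
     + Dt * total_deriv (total_deriv (fps_nth (f s 0) n)) J)"
    by (intro differential_function_add differential_function_cmult differential_function_total_deriv
        differential_speed_mult assms)
  then show ?thesis
    by (simp add: closed_rate_nth[abs_def])
qed

lemma differential_rho: "differential_function \<Omega> (rho s)"
  using differential_function_coord[of s 0] by (simp add: rho_def[abs_def] densities_def)

lemma differential_hierarchy_map:
  assumes f: "\<And>s m n. differential_function \<Omega> (fps_nth (f s m) n)"
  shows "differential_function \<Omega> (fps_nth (hierarchy_map v Dt \<gamma> f s m) n)"
proof (cases "m = 0")
  case True
  then show ?thesis
    using differential_rho differential_function_const[of 0]
    by (simp add: hierarchy_map_def zero_fun_def)
next
  case False
  have "differential_function \<Omega> (fps_nth (f s (m - 1) + f s (m + 1)) n)" for n
    using differential_function_add[OF f f] by (simp add: plus_fun_def)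
  note flux = differential_function_cmult[OF differential_function_total_deriv[OF differential_speed_mult[OF this]], of "- (1/2)"]
  have drift: "differential_function \<Omega> (\<lambda>J. Dt * total_deriv (total_deriv (fps_nth (f s m) (n - 2))) J
           - (\<Sum>i\<le>n - 2. frechet_along (\<lambda>u. fps_nth (closed_rate v Dt f u) (n - 2 - i))
                 (fps_nth (f s m) i) J))"
    by (intro differential_function_diff differential_function_cmult differential_function_sum
        differential_function_total_deriv differential_function_frechet_along differential_closed_rate f)
  have if_dist: "differential_function \<Omega> (\<lambda>J. if b then 0 else h J)"
    if "differential_function \<Omega> h" for b and h :: "'s jet \<Rightarrow> real"
    using that by (cases b) (simp_all add: differential_function_const)
  show ?thesis
    unfolding hierarchy_map_nth[OF False, abs_def]
    by (intro differential_function_cmult differential_function_add if_dist flux drift)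
qed

definition slaved_fixpoint :: "(nat \<Rightarrow> real) \<Rightarrow> ('s \<Rightarrow> nat \<Rightarrow> 's dseries) \<Rightarrow> bool" where
  "slaved_fixpoint \<gamma> f \<longleftrightarrow>
     (\<forall>s m n. differential_function \<Omega> (fps_nth (f s m) n)) \<and>
     (\<forall>s m n. fps_nth (f s m) n \<doteq> fps_nth (hierarchy_map v Dt \<gamma> f s m) n)"

text \<open>The rate is obtained from the density equation shifted by two orders; substituting it into the
moment equations and dividing by the positive \<open>\<gamma> m\<close> yields the fixed-point equation.\<close>
lemma slaved_expansion_fixpoint:
  assumes pos: "\<forall>m\<ge>1. \<gamma> m > 0" and sl: "slaved_expansion \<Omega> v Dt \<gamma> f P"
  shows "slaved_fixpoint \<gamma> f" and "fps_nth (P s) n \<doteq> fps_nth (closed_rate v Dt f s) n"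
proof -
  have diff: "differential_function \<Omega> (fps_nth (f s m) n)"
    and f0: "f s 0 = fps_const (rho s)" for s m n
    using sl unfolding slaved_expansion_def by blast+
  have fm: "series_eq_on \<Omega>
        (fps_X ^ 2 * series_dT P (f s m))
        (- series_const (1 / 2) * fps_X *
             series_dX (speed_series v s * (f s (m - 1) + f s (m + 1)))
         + fps_X ^ 2 * series_const Dt * series_dX (series_dX (f s m))
         - series_const (\<gamma> m) * f s m)" if "m \<ge> 1" for s m
    using sl that unfolding slaved_expansion_def by blast
  have P: "series_eq_on \<Omega> (fps_X ^ 2 * P s)
        (- fps_X * series_dX (speed_series v s * f s 1)
         + fps_X ^ 2 * series_const Dt * series_dX (series_dX (f s 0)))" for s
    using sl unfolding slaved_expansion_def by blast
  have rate: "fps_nth (P s) n \<doteq> fps_nth (closed_rate v Dt f s) n" for s n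
  proof
    fix J assume "J \<in> jets_over \<Omega>"
    then have "fps_nth (fps_X ^ 2 * P s) (n + 2) J =
        fps_nth (- series_const 1 * fps_X * series_dX (speed_series v s * f s 1)
         + fps_X ^ 2 * series_const Dt * series_dX (series_dX (f s 0))) (n + 2) J"
      using P[of s] unfolding series_eq_on_def series_const_1 by simp
    then show "fps_nth (P s) n J = fps_nth (closed_rate v Dt f s) n J"
      unfolding moment_rhs_nth by (simp add: fps_X_power_mult_nth closed_rate_nth series_dX_def)
  qed
  then show "fps_nth (P s) n \<doteq> fps_nth (closed_rate v Dt f s) n" .
  show "slaved_fixpoint \<gamma> f"
    unfolding slaved_fixpoint_def
  proof (intro conjI allI diff)
    fix s m n
    show "fps_nth (f s m) n \<doteq> fps_nth (hierarchy_map v Dt \<gamma> f s m) n"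
    proof (cases "m = 0")
      case True
      then show ?thesis by (simp add: f0 hierarchy_map_def)
    next
      case False
      show ?thesis
      proof
        fix J assume J: "J \<in> jets_over \<Omega>"
        have "fps_nth (fps_X ^ 2 * series_dT P (f s m)) n J =
            fps_nth (- series_const (1 / 2) * fps_X *
             series_dX (speed_series v s * (f s (m - 1) + f s (m + 1)))
              + fps_X ^ 2 * series_const Dt * series_dX (series_dX (f s m))) n J
            - \<gamma> m * fps_nth (f s m) n J"
          using fm[of m s] False J by (simp add: series_eq_on_def series_const_def)
        moreover have "fps_nth (series_dT P (f s m)) k J =
            (\<Sum>i\<le>k. frechet_along (\<lambda>u. fps_nth (closed_rate v Dt f u) (k - i)) (fps_nth (f s m) i) J)" for k
          unfolding series_dT_def
          by (simp, intro sum.cong refl frechet_along_cong[OF _ _ J]) (use rate in auto)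
        moreover have cancel: "\<gamma> m * (inverse (\<gamma> m) * x) = x" for x
          using pos[rule_format, of m] False by simp
        ultimately have "\<gamma> m * fps_nth (f s m) n J = \<gamma> m * fps_nth (hierarchy_map v Dt \<gamma> f s m) n J"
          unfolding hierarchy_map_nth[OF False] moment_rhs_nth cancel
          by (simp add: fps_X_power_mult_nth series_dX_def split: if_splits)
        then show "fps_nth (f s m) n J = fps_nth (hierarchy_map v Dt \<gamma> f s m) n J"
          using pos[rule_format, of m] False by simp
      qed
    qed
  qed
qed

text \<open>Orders 0 and 1 of the density equation do not determine the rate but are constraints. The one at order 1
says that the flux of the order 0 coefficient of the first harmonic vanishes, which holds because that
coefficient itself is zero for any fixed point.\<close>
lemma fixpoint_slaved_expansion:
  assumes pos: "\<forall>m\<ge>1. \<gamma> m > 0" and fp: "slaved_fixpoint \<gamma> f" and f0: "\<And>s. f s 0 = fps_const (rho s)"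
  shows "slaved_expansion \<Omega> v Dt \<gamma> f (closed_rate v Dt f)"
proof -
  have diff: "differential_function \<Omega> (fps_nth (f s m) n)"
    and fix_eq: "fps_nth (f s m) n \<doteq> fps_nth (hierarchy_map v Dt \<gamma> f s m) n" for s m n
    using fp unfolding slaved_fixpoint_def by blast+
  have "series_eq_on \<Omega>
        (fps_X ^ 2 * series_dT (closed_rate v Dt f) (f s m))
        (- series_const (1 / 2) * fps_X *
             series_dX (speed_series v s * (f s (m - 1) + f s (m + 1)))
         + fps_X ^ 2 * series_const Dt * series_dX (series_dX (f s m))
         - series_const (\<gamma> m) * f s m)" if "m \<ge> 1" for s m
    unfolding series_eq_on_def fps_sub_nth minus_apply moment_rhs_nth series_const_mult_nth
  proof (intro allI ballI)
    fix n J assume J: "J \<in> jets_over \<Omega>"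
    have m: "m \<noteq> 0" "\<gamma> m > 0" using that pos by auto
    have cancel: "\<gamma> m * (inverse (\<gamma> m) * x) = x" for x
      using m(2) by simp
    have "\<gamma> m * fps_nth (f s m) n J = \<gamma> m * fps_nth (hierarchy_map v Dt \<gamma> f s m) n J"
      using fix_eq J by simp
    then show "fps_nth (fps_X ^ 2 * series_dT (closed_rate v Dt f) (f s m)) n J =
      (if n = 0 then 0 else - (1/2) * fps_nth (series_dX (speed_series v s * (f s (m - 1) + f s (m + 1)))) (n - 1) J)
       + (if n < 2 then 0 else Dt * fps_nth (series_dX (series_dX (f s m))) (n - 2) J)
       - \<gamma> m * fps_nth (f s m) n J"
      unfolding hierarchy_map_nth[OF m(1)] cancel
      by (simp add: fps_X_power_mult_nth series_dX_def series_dT_def)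
  qed
  moreover have "series_eq_on \<Omega> (fps_X ^ 2 * closed_rate v Dt f s)
        (- fps_X * series_dX (speed_series v s * f s 1)
         + fps_X ^ 2 * series_const Dt * series_dX (series_dX (f s 0)))" for s
  proof -
    have "fps_nth (f s 1) 0 \<doteq> fps_nth 0 0"
      using fix_eq[of s 1 0] by (simp add: hierarchy_map_nth)
    then have "total_deriv (fps_nth (speed_series v s * f s 1) 0) \<doteq> total_deriv (fps_nth (speed_series v s * 0) 0)"
      by (intro flux_cong) simp
    then have flux0: "total_deriv (fps_nth (speed_series v s * f s 1) 0) \<doteq> (\<lambda>_. 0)"
      by (simp add: zero_fun_def total_deriv_0)
    have "fps_nth (fps_X ^ 2 * closed_rate v Dt f s) n J =
        fps_nth (- series_const 1 * fps_X * series_dX (speed_series v s * f s 1)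
         + fps_X ^ 2 * series_const Dt * series_dX (series_dX (f s 0))) n J"
      if J: "J \<in> jets_over \<Omega>" for n J
    proof -
      consider "n = 0" | "n = 1" | k where "n = k + 2"
        by (metis One_nat_def Suc_1 add.commute add_2_eq_Suc' not0_implies_Suc)
      then show ?thesis
        unfolding moment_rhs_nth using flux0 J
        by cases (simp_all add: fps_X_power_mult_nth closed_rate_nth series_dX_def)
    qed
    then show ?thesis
      unfolding series_eq_on_def series_const_1 by simp
  qed
  ultimately show ?thesis
    unfolding slaved_expansion_def using diff f0 differential_closed_rate[of f] by blast
qed

section \<open>Existence and uniqueness of the slaved expansion\<close>

text \<open>The map gains one order of \<open>\<delta>\<close>: transport carries a factor \<open>\<delta>\<close>, and diffusion and the slow-time
derivative carry \<open>\<delta>\<^sup>2\<close>, of which the rate consumes at most one power.\<close>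
lemma hierarchy_map_contracts:
  assumes "\<And>s m i. i < n \<Longrightarrow> fps_nth (f s m) i \<doteq> fps_nth (g s m) i"
  shows "fps_nth (hierarchy_map v Dt \<gamma> f s m) n \<doteq> fps_nth (hierarchy_map v Dt \<gamma> g s m) n"
proof (cases "m = 0")
  case True
  then show ?thesis by (simp add: hierarchy_map_def)
next
  case False
  show ?thesis
  proof (rule hierarchy_map_cong[OF False refl])
    fix i assume i: "i + 2 \<le> n"
    have "fps_nth (closed_rate v Dt f u) (n - 2 - i) \<doteq> fps_nth (closed_rate v Dt g u) (n - 2 - i)" for u
      by (rule closed_rate_cong) (use assms i in auto)
    moreover have "fps_nth (f s m) i \<doteq> fps_nth (g s m) i"
      using assms i by simp
    ultimately show "frechet_along (\<lambda>u. fps_nth (closed_rate v Dt f u) (n - 2 - i)) (fps_nth (f s m) i) \<doteq>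
      frechet_along (\<lambda>u. fps_nth (closed_rate v Dt g u) (n - 2 - i)) (fps_nth (g s m) i)"
      by (auto intro!: frechet_along_cong)
  qed (use assms in auto)
qed

text \<open>Iterating from zero, the coefficient of order \<open>n\<close> is stationary from iterate \<open>n + 1\<close> on; the diagonal
sequence of coefficients is the fixed point.\<close>
lemma slaved_fixpoint_exists:
  "\<exists>f. slaved_fixpoint \<gamma> f \<and> (\<forall>s. f s 0 = fps_const (rho s))"
proof -
  define F where "F = (\<lambda>k. (hierarchy_map v Dt \<gamma> ^^ k) (\<lambda>_ _. 0))"
  have F_Suc: "F (Suc k) = hierarchy_map v Dt \<gamma> (F k)" for k
    by (simp add: F_def)
  have diffF: "differential_function \<Omega> (fps_nth (F k s m) n)" for k s m n
  proof (induction k arbitrary: s m n)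
    case 0
    then show ?case
      using differential_function_const[of 0] by (simp add: F_def zero_fun_def)
  next
    case (Suc k)
    then show ?case by (simp add: F_Suc differential_hierarchy_map)
  qed
  have refine: "fps_nth (F k s m) i \<doteq> fps_nth (F (Suc k) s m) i" if "i < k" for i k s m
    using that
  proof (induction k arbitrary: i s m)
    case (Suc k)
    have "fps_nth (hierarchy_map v Dt \<gamma> (F k) s m) i \<doteq> fps_nth (hierarchy_map v Dt \<gamma> (F (Suc k)) s m) i"
      by (rule hierarchy_map_contracts) (use Suc in auto)
    then show ?case by (simp only: F_Suc)
  qed simp
  have stable: "fps_nth (F k s m) i \<doteq> fps_nth (F (Suc i) s m) i" if "i < k" for i k s m
  proof -
    from that have "Suc i \<le> k" by simp
    then show ?thesis
    proof (induction k rule: dec_induct)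
      case (step k)
      then show ?case using refine[of i k s m] by simp
    qed simp
  qed
  define f where "f = (\<lambda>s m. Abs_fps (\<lambda>n. fps_nth (F (Suc n) s m) n))"
  have f_nth: "fps_nth (f s m) n = fps_nth (F (Suc n) s m) n" for s m n
    by (simp add: f_def)
  have "fps_nth (f s m) n \<doteq> fps_nth (hierarchy_map v Dt \<gamma> f s m) n" for s m n
  proof -
    have "fps_nth (hierarchy_map v Dt \<gamma> f s m) n \<doteq> fps_nth (hierarchy_map v Dt \<gamma> (F n) s m) n"
    proof (rule hierarchy_map_contracts)
      fix s m i assume "i < n"
      from stable[OF this, of s m] show "fps_nth (f s m) i \<doteq> fps_nth (F n s m) i"
        unfolding f_nth by metis
    qed
    then show ?thesis by (simp add: f_nth F_Suc)
  qed
  moreover have "f s 0 = fps_const (rho s)" for s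
    by (rule fps_ext) (simp add: f_nth F_Suc hierarchy_map_def)
  ultimately show ?thesis
    unfolding slaved_fixpoint_def using diffF by (intro exI[of _ f]) (auto simp: f_nth)
qed

lemma slaved_fixpoint_unique:
  assumes "slaved_fixpoint \<gamma> f" "slaved_fixpoint \<gamma> g"
  shows "fps_nth (f s m) n \<doteq> fps_nth (g s m) n"
proof (induction n arbitrary: s m rule: less_induct)
  case (less n)
  have "fps_nth (hierarchy_map v Dt \<gamma> f s m) n \<doteq> fps_nth (hierarchy_map v Dt \<gamma> g s m) n"
    by (rule hierarchy_map_contracts) (rule less)
  then show ?case
    using assms unfolding slaved_fixpoint_def by simp
qed

section \<open>Parity and dependence on the rates\<close>

lemma closed_rate_parity:
  assumes "\<And>i. i \<le> Suc n \<Longrightarrow> even i \<Longrightarrow> fps_nth (f s 1) i \<doteq> 0" "fps_nth (f s 0) n \<doteq> 0" "odd n"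
  shows "fps_nth (closed_rate v Dt f s) n \<doteq> 0"
proof -
  have "fps_nth (closed_rate v Dt f s) n \<doteq> fps_nth (closed_rate v Dt (\<lambda>_ _. 0) s) n"
    by (rule closed_rate_cong) (use assms in auto)
  then show ?thesis
    by (simp add: closed_rate_nth zero_fun_def total_deriv_0)
qed

text \<open>Every term of the recursion preserves the claim when the orders below \<open>n\<close> satisfy it. In the slow-time
term the harmonic contributes only at orders of the parity of \<open>m\<close>, and then, for
\<open>n\<close> of the opposite parity, the rate is needed at an odd order, where it vanishes.\<close>
lemma slaved_fixpoint_parity:
  assumes fp: "slaved_fixpoint \<gamma> f" and "n < m \<or> odd (n + m)"
  shows "fps_nth (f s m) n \<doteq> 0"
  using assms(2)
proof (induction n arbitrary: s m rule: less_induct)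
  case (less n)
  have fix_eq: "fps_nth (f s m) n \<doteq> fps_nth (hierarchy_map v Dt \<gamma> f s m) n" for s m n
    using fp unfolding slaved_fixpoint_def by blast
  show ?case
  proof (cases "m = 0")
    case True
    then show ?thesis
      using fix_eq[of s m n] less.prems by (auto simp: hierarchy_map_def)
  next
    case False
    have "fps_nth (hierarchy_map v Dt \<gamma> f s m) n \<doteq> fps_nth (hierarchy_map v Dt \<gamma> (\<lambda>_ _. 0) s m) n"
    proof (rule hierarchy_map_cong[OF False refl])
      fix i assume i: "i + 2 \<le> n"
      have "(fps_nth (f s m) i \<doteq> (\<lambda>_. 0)) \<or> (\<forall>u. fps_nth (closed_rate v Dt f u) (n - 2 - i) \<doteq> (\<lambda>_. 0))"
      proof (cases "i < m \<or> odd (i + m)")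
        case True
        then show ?thesis using less.IH[of i m s] i by simp
      next
        case False
        then have odd: "odd (n - 2 - i)" using less.prems i by auto
        have "fps_nth (closed_rate v Dt f u) (n - 2 - i) \<doteq> 0" for u
        proof (rule closed_rate_parity[OF _ _ odd])
          show "fps_nth (f u 0) (n - 2 - i) \<doteq> 0"
            using less.IH[of "n - 2 - i" 0 u] i odd by simp
          show "fps_nth (f u 1) j \<doteq> 0" if "j \<le> Suc (n - 2 - i)" "even j" for j
            using less.IH[of j 1 u] that i by simp
        qed
        then show ?thesis by simp
      qed
      then show "frechet_along (\<lambda>u. fps_nth (closed_rate v Dt f u) (n - 2 - i)) (fps_nth (f s m) i) \<doteq>
          frechet_along (\<lambda>u. fps_nth (closed_rate v Dt (\<lambda>_ _. 0) u) (n - 2 - i)) (fps_nth 0 i)"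
        by (auto simp: frechet_along_eq_0)
    next
      fix i assume i: "i < n" "even (n - 1 - i)"
      have "i < m - 1 \<or> odd (i + (m - 1))" "i < m + 1 \<or> odd (i + (m + 1))"
        using less.prems False i by presburger+
      then show "fps_nth (f s (m - 1)) i \<doteq> fps_nth 0 i" "fps_nth (f s (m + 1)) i \<doteq> fps_nth 0 i"
        using less.IH[OF i(1)] by simp_all
    next
      assume n: "2 \<le> n"
      have "n - 2 < m \<or> odd (n - 2 + m)"
        using less.prems n by auto
      then show "fps_nth (f s m) (n - 2) \<doteq> fps_nth 0 (n - 2)"
        using less.IH[of "n - 2"] n by simp
    qed
    moreover have "fps_nth (hierarchy_map v Dt \<gamma> (\<lambda>_ _. 0) s m) n \<doteq> 0"
      using False by (auto simp: hierarchy_map_nth zero_fun_def total_deriv_0 frechet_along_eq_0)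
    ultimately show ?thesis using fix_eq[of s m n] by simp
  qed
qed

text \<open>As \<open>f s m\<close> starts at order \<open>m\<close>, the slow-time term at order \<open>n\<close> uses the rate at most to order \<open>n - 2 - m\<close>
and hence the first harmonic at most to order \<open>n - 1 - m\<close>. This sharp bound keeps the
term away from the diagonal \<open>n + m = 2 * M + 2\<close> on which the first difference lives.\<close>
lemma frechet_agree:
  assumes f: "slaved_fixpoint \<gamma> f" and g: "slaved_fixpoint \<gamma>' g"
    and i: "i + 2 \<le> n" and fi: "fps_nth (f s m) i \<doteq> fps_nth (g s m) i"
    and f1: "\<And>u j. j + m + 1 \<le> n \<Longrightarrow> fps_nth (f u 1) j \<doteq> fps_nth (g u 1) j"
  shows "frechet_along (\<lambda>u. fps_nth (closed_rate v Dt f u) (n - 2 - i)) (fps_nth (f s m) i) \<doteq>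
      frechet_along (\<lambda>u. fps_nth (closed_rate v Dt g u) (n - 2 - i)) (fps_nth (g s m) i)"
proof (cases "i < m")
  case True
  then show ?thesis
    using slaved_fixpoint_parity[OF f, of i m s] slaved_fixpoint_parity[OF g, of i m s]
    by (simp add: frechet_along_eq_0)
next
  case False
  have "fps_nth (closed_rate v Dt f u) (n - 2 - i) \<doteq> fps_nth (closed_rate v Dt g u) (n - 2 - i)" for u
  proof (rule closed_rate_cong)
    show "fps_nth (f u 1) j \<doteq> fps_nth (g u 1) j" if "j \<le> Suc (n - 2 - i)" for j
      by (rule f1) (use that False i in auto)
    show "fps_nth (f u 0) (n - 2 - i) \<doteq> fps_nth (g u 0) (n - 2 - i)"
      using f g unfolding slaved_fixpoint_def by (simp add: hierarchy_map_def)
  qed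
  then show ?thesis
    using fi by (auto intro!: frechet_along_cong)
qed

text \<open>The quantity \<open>n + m\<close> does not increase along the recursion: going from order \<open>n\<close> to \<open>n - 1\<close> raises
the harmonic index by at most one. The relaxation rate used at the current
step is \<open>\<gamma> m\<close>, and \<open>m \<le> (n + m) div 2\<close> whenever the coefficient can be nonzero.\<close>
lemma slaved_fixpoint_rate_dependence:
  assumes f: "slaved_fixpoint \<gamma> f" and g: "slaved_fixpoint \<gamma>' g"
    and "\<forall>l\<in>{1..(n + m) div 2}. \<gamma> l = \<gamma>' l"
  shows "fps_nth (f s m) n \<doteq> fps_nth (g s m) n"
  using assms(3)
proof (induction n arbitrary: s m rule: less_induct)
  case (less n)
  have IH: "fps_nth (f u l) i \<doteq> fps_nth (g u l) i" if "i < n" "i + l \<le> n + m" for u l i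
  proof (rule less.IH[OF that(1)])
    have "(i + l) div 2 \<le> (n + m) div 2" using that(2) by (rule div_le_mono)
    then show "\<forall>l\<in>{1..(i + l) div 2}. \<gamma> l = \<gamma>' l" using less.prems by auto
  qed
  have fix_eq: "fps_nth (f s m) n \<doteq> fps_nth (hierarchy_map v Dt \<gamma> f s m) n"
      "fps_nth (g s m) n \<doteq> fps_nth (hierarchy_map v Dt \<gamma>' g s m) n"
    using f g unfolding slaved_fixpoint_def by blast+
  consider "m = 0" | "n < m" | "m \<noteq> 0" "m \<le> n" by linarith
  then show ?case
  proof cases
    case 1
    then show ?thesis using fix_eq by (simp add: hierarchy_map_def)
  next
    case 2
    then show ?thesis
      using slaved_fixpoint_parity[OF f, of n m s] slaved_fixpoint_parity[OF g, of n m s] by simp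
  next
    case 3
    have "fps_nth (hierarchy_map v Dt \<gamma> f s m) n \<doteq> fps_nth (hierarchy_map v Dt \<gamma>' g s m) n"
    proof (rule hierarchy_map_cong[OF 3(1)])
      show "\<gamma> m = \<gamma>' m" using 3 less.prems by auto
      show "frechet_along (\<lambda>u. fps_nth (closed_rate v Dt f u) (n - 2 - i)) (fps_nth (f s m) i) \<doteq>
          frechet_along (\<lambda>u. fps_nth (closed_rate v Dt g u) (n - 2 - i)) (fps_nth (g s m) i)"
        if "i + 2 \<le> n" for i
        by (rule frechet_agree[OF f g that]) (use that in \<open>auto intro!: IH[rule_format]\<close>)
    qed (use IH in auto)
    then show ?thesis using fix_eq by simp
  qed
qed

lemma slaved_fixpoint_agree_below:
  assumes f: "slaved_fixpoint \<gamma> f" and g: "slaved_fixpoint \<gamma>' g"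
    and eq: "\<forall>l\<in>{1..M}. \<gamma> l = \<gamma>' l" and "n + m \<le> 2 * M + 1"
  shows "fps_nth (f s m) n \<doteq> fps_nth (g s m) n"
proof (rule slaved_fixpoint_rate_dependence[OF f g])
  have "(n + m) div 2 \<le> M" using assms(4) by simp
  then show "\<forall>l\<in>{1..(n + m) div 2}. \<gamma> l = \<gamma>' l" using eq by auto
qed

lemma closed_rate_dependence:
  assumes f: "slaved_fixpoint \<gamma> f" and g: "slaved_fixpoint \<gamma>' g"
    and eq: "\<forall>l\<in>{1..(n + 2) div 2}. \<gamma> l = \<gamma>' l"
  shows "fps_nth (closed_rate v Dt f s) n \<doteq> fps_nth (closed_rate v Dt g s) n"
proof (rule closed_rate_cong)
  fix i assume "i \<le> Suc n"
  then have "(i + 1) div 2 \<le> (n + 2) div 2" by (intro div_le_mono) simp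
  then show "fps_nth (f s 1) i \<doteq> fps_nth (g s 1) i"
    by (intro slaved_fixpoint_rate_dependence[OF f g]) (use eq in auto)
next
  show "fps_nth (f s 0) n \<doteq> fps_nth (g s 0) n"
    using f g unfolding slaved_fixpoint_def by (simp add: hierarchy_map_def)
qed

section \<open>The first difference of two closures\<close>

text \<open>The operator \<open>flux_deriv V s\<close>, expressed through the leading speed coefficient as it occurs in the
hierarchy; over \<open>\<Omega>\<close> the two coincide.\<close>
definition transport :: "'s \<Rightarrow> ('s jet \<Rightarrow> real) \<Rightarrow> 's jet \<Rightarrow> real" where
  "transport s g = total_deriv (\<lambda>J. v s 0 J * g J)"

lemma differential_transport_funpow: "differential_function \<Omega> ((transport s ^^ n) (rho s))"
  by (induction n)
    (auto simp: transport_def differential_rho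
      intro: differential_function_total_deriv differential_function_mult speed_differential)

lemma transport_scaled_funpow:
  assumes "g \<doteq> (\<lambda>J. c * (transport s ^^ n) (rho s) J)" "J \<in> jets_over \<Omega>"
  shows "transport s g J = c * (transport s ^^ Suc n) (rho s) J"
proof -
  have "transport s g J = total_deriv (\<lambda>J. c * (v s 0 J * (transport s ^^ n) (rho s) J)) J"
    unfolding transport_def[of s g] by (rule total_deriv_cong[OF _ assms(2)]) (use assms(1) in simp)
  also have "\<dots> = c * (transport s ^^ Suc n) (rho s) J"
    by (simp add: transport_def total_deriv_cmult[OF differential_function_mult[OF
          speed_differential differential_transport_funpow] assms(2)])
  finally show ?thesis .
qed

text \<open>On the diagonal \<open>n = m\<close> only the transport out of the harmonic below survives, since the harmonic above,
diffusion and slow time all refer to coefficients below their own diagonal.\<close>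
lemma leading_coefficient:
  assumes f: "slaved_fixpoint \<gamma> f"
  shows "fps_nth (f s m) m \<doteq>
    (\<lambda>J. (- 1 / 2) ^ m * (\<Prod>j=1..m. inverse (\<gamma> j)) * (transport s ^^ m) (rho s) J)"
proof (induction m)
  case 0
  then show ?case
    using f unfolding slaved_fixpoint_def by (simp add: hierarchy_map_def)
next
  case (Suc m)
  have diff: "differential_function \<Omega> (fps_nth (f s m) n)"
    and fix_eq: "fps_nth (f s m) n \<doteq> fps_nth (hierarchy_map v Dt \<gamma> f s m) n" for s m n
    using f unfolding slaved_fixpoint_def by blast+
  have below: "fps_nth (f u l) i \<doteq> 0" if "i < l" for u l i
    using slaved_fixpoint_parity[OF f] that by blast
  let ?z = "(\<lambda>_ _. 0) :: 's \<Rightarrow> nat \<Rightarrow> 's dseries"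
  show ?case
  proof
    fix J assume J: "J \<in> jets_over \<Omega>"
    have "fps_nth (hierarchy_map v Dt \<gamma> f s (Suc m)) (Suc m) J
        - fps_nth (hierarchy_map v Dt \<gamma> ?z s (Suc m)) (Suc m) J =
      - (inverse (\<gamma> (Suc m)) / 2) * total_deriv (\<lambda>J. v s 0 J *
        ((fps_nth (f s (Suc m - 1)) (Suc m - 1) J - fps_nth (?z s (Suc m - 1)) (Suc m - 1) J) +
         (fps_nth (f s (Suc m + 1)) (Suc m - 1) J - fps_nth (?z s (Suc m + 1)) (Suc m - 1) J))) J"
    proof (rule hierarchy_map_diff_top[OF _ refl _ diff _ _ _ _ _ J])
      show "differential_function \<Omega> (fps_nth (?z s m) n)" for s m n
        using differential_function_const[of 0] by (simp add: zero_fun_def)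
      show "frechet_along (\<lambda>u. fps_nth (closed_rate v Dt f u) (Suc m - 2 - i)) (fps_nth (f s (Suc m)) i) \<doteq>
          frechet_along (\<lambda>u. fps_nth (closed_rate v Dt ?z u) (Suc m - 2 - i)) (fps_nth (?z s (Suc m)) i)"
        if "i + 2 \<le> Suc m" for i
        using that below[of i "Suc m" s] by (simp add: frechet_along_eq_0)
    qed (use below in auto)
    moreover have "fps_nth (hierarchy_map v Dt \<gamma> ?z s (Suc m)) (Suc m) J = 0"
      using J by (simp add: hierarchy_map_nth zero_fun_def total_deriv_0 frechet_along_eq_0)
    moreover have "total_deriv (\<lambda>J. v s 0 J *
        ((fps_nth (f s (Suc m - 1)) (Suc m - 1) J - fps_nth (?z s (Suc m - 1)) (Suc m - 1) J) +
         (fps_nth (f s (Suc m + 1)) (Suc m - 1) J - fps_nth (?z s (Suc m + 1)) (Suc m - 1) J))) J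
        = transport s (fps_nth (f s m) m) J"
      unfolding transport_def
      by (rule total_deriv_cong[OF _ J]) (use below[of m "Suc m + 1" s] in simp)
    ultimately have "fps_nth (f s (Suc m)) (Suc m) J =
        - (inverse (\<gamma> (Suc m)) / 2) * transport s (fps_nth (f s m) m) J"
      using fix_eq[of s "Suc m" "Suc m"] J by simp
    then show "fps_nth (f s (Suc m)) (Suc m) J =
        (- 1 / 2) ^ Suc m * (\<Prod>j=1..Suc m. inverse (\<gamma> j)) * (transport s ^^ Suc m) (rho s) J"
      unfolding transport_scaled_funpow[OF Suc.IH J] by simp
  qed
qed

text \<open>Along the antidiagonal of orders \<open>M + 1 + k\<close> and harmonics \<open>M + 1 - k\<close> two expansions can first differ. At \<open>k = 0\<close>
the difference comes from \<open>\<gamma> (M + 1)\<close> in the leading coefficient; each further step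
is transport from the harmonic above, because everything else entering the recursion lies on a
lower antidiagonal, where the expansions agree. The factors \<open>inverse (\<gamma> j)\<close> are thus collected once on the
way up and once on the way down.\<close>
lemma first_difference_moment:
  assumes f: "slaved_fixpoint \<gamma> f" and g: "slaved_fixpoint \<gamma>' g"
    and eq: "\<forall>l\<in>{1..M}. \<gamma> l = \<gamma>' l" and "k \<le> M"
  shows "(\<lambda>J. fps_nth (f s (M + 1 - k)) (M + 1 + k) J - fps_nth (g s (M + 1 - k)) (M + 1 + k) J) \<doteq>
    (\<lambda>J. (- 1 / 2) ^ (M + 1 + k) * (inverse (\<gamma> (M + 1)) - inverse (\<gamma>' (M + 1))) *
      (\<Prod>j=1..M. inverse (\<gamma> j)) * (\<Prod>j=M+1-k..M. inverse (\<gamma> j)) *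
      (transport s ^^ (M + 1 + k)) (rho s) J)"
  using assms(4)
proof (induction k)
  case 0
  have "(\<Prod>j=1..M. inverse (\<gamma>' j)) = (\<Prod>j=1..M. inverse (\<gamma> j))"
    by (rule prod.cong) (use eq in auto)
  then have prods: "(\<Prod>j=1..M+1. inverse (\<gamma> j)) = (\<Prod>j=1..M. inverse (\<gamma> j)) * inverse (\<gamma> (M + 1))"
      "(\<Prod>j=1..M+1. inverse (\<gamma>' j)) = (\<Prod>j=1..M. inverse (\<gamma> j)) * inverse (\<gamma>' (M + 1))"
    by simp_all
  have empty: "(\<Prod>j=M+1..M. inverse (\<gamma> j)) = 1"
    by simp
  have collect: "c * (p * x) * t - c * (p * y) * t = c * (x - y) * p * 1 * t" for c p x y t :: real
    by (simp add: algebra_simps)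
  show ?case
    using leading_coefficient[OF f, of s "M + 1"] leading_coefficient[OF g, of s "M + 1"]
    unfolding diff_zero add_0_right prods empty collect[symmetric] by simp
next
  case (Suc k)
  define m where "m = M - k"
  define n where "n = M + 2 + k"
  have m: "m \<noteq> 0" "m + n = 2 * M + 2" "m \<le> M" "n \<noteq> 0" "\<gamma> m = \<gamma>' m"
    using Suc.prems eq by (auto simp: m_def n_def)
  have idx: "M + 1 - Suc k = m" "M + 1 + Suc k = n" "M + 1 - k = m + 1" "M + 1 + k = n - 1"
    using Suc.prems by (auto simp: m_def n_def)
  have diff: "differential_function \<Omega> (fps_nth (f s m) n)" "differential_function \<Omega> (fps_nth (g s m) n)"
    and fix_eq: "fps_nth (f s m) n \<doteq> fps_nth (hierarchy_map v Dt \<gamma> f s m) n"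
      "fps_nth (g s m) n \<doteq> fps_nth (hierarchy_map v Dt \<gamma>' g s m) n" for s m n
    using f g unfolding slaved_fixpoint_def by blast+
  note agree = slaved_fixpoint_agree_below[OF f g eq]
  show ?case
    unfolding idx
  proof
    fix J assume J: "J \<in> jets_over \<Omega>"
    have "fps_nth (hierarchy_map v Dt \<gamma> f s m) n J - fps_nth (hierarchy_map v Dt \<gamma>' g s m) n J =
      - (inverse (\<gamma> m) / 2) * total_deriv (\<lambda>J. v s 0 J *
        ((fps_nth (f s (m - 1)) (n - 1) J - fps_nth (g s (m - 1)) (n - 1) J) +
         (fps_nth (f s (m + 1)) (n - 1) J - fps_nth (g s (m + 1)) (n - 1) J))) J"
    proof (rule hierarchy_map_diff_top[where f = f and g = g and m = m and \<gamma> = \<gamma> and \<gamma>' = \<gamma>', OF m(1,5,4) diff _ _ _ _ J])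
      show "fps_nth (f s (m - 1)) i \<doteq> fps_nth (g s (m - 1)) i"
           "fps_nth (f s (m + 1)) i \<doteq> fps_nth (g s (m + 1)) i" if "i < n - 1" for i
        by (rule agree, use that m in linarith)+
      show "fps_nth (f s m) (n - 2) \<doteq> fps_nth (g s m) (n - 2)" if "2 \<le> n"
        by (rule agree) (use that m in linarith)
      show "frechet_along (\<lambda>u. fps_nth (closed_rate v Dt f u) (n - 2 - i)) (fps_nth (f s m) i) \<doteq>
          frechet_along (\<lambda>u. fps_nth (closed_rate v Dt g u) (n - 2 - i)) (fps_nth (g s m) i)"
        if "i + 2 \<le> n" for i
      proof (rule frechet_agree[OF f g that])
        show "fps_nth (f s m) i \<doteq> fps_nth (g s m) i"
          by (rule agree) (use that m in linarith)
        show "fps_nth (f u 1) j \<doteq> fps_nth (g u 1) j" if "j + m + 1 \<le> n" for u j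
          by (rule agree) (use that m in linarith)
      qed
    qed
    moreover have "total_deriv (\<lambda>J. v s 0 J *
        ((fps_nth (f s (m - 1)) (n - 1) J - fps_nth (g s (m - 1)) (n - 1) J) +
         (fps_nth (f s (m + 1)) (n - 1) J - fps_nth (g s (m + 1)) (n - 1) J))) J
      = transport s (\<lambda>J. fps_nth (f s (m + 1)) (n - 1) J - fps_nth (g s (m + 1)) (n - 1) J) J"
    proof -
      have "fps_nth (f s (m - 1)) (n - 1) \<doteq> fps_nth (g s (m - 1)) (n - 1)"
        by (rule agree) (use m in linarith)
      then show ?thesis
        unfolding transport_def by (intro total_deriv_cong[OF _ J]) simp
    qed
    moreover have "transport s (\<lambda>J. fps_nth (f s (m + 1)) (n - 1) J - fps_nth (g s (m + 1)) (n - 1) J) J =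
      ((- 1 / 2) ^ (n - 1) * (inverse (\<gamma> (M + 1)) - inverse (\<gamma>' (M + 1))) *
      (\<Prod>j=1..M. inverse (\<gamma> j)) * (\<Prod>j=m+1..M. inverse (\<gamma> j))) * (transport s ^^ Suc (n - 1)) (rho s) J"
      by (rule transport_scaled_funpow[OF Suc.IH[OF Suc_leD[OF Suc.prems], unfolded idx] J])
    moreover have "(\<Prod>j=m..M. inverse (\<gamma> j)) = inverse (\<gamma> m) * (\<Prod>j=m+1..M. inverse (\<gamma> j))"
      using prod.atLeast_Suc_atMost[OF m(3), of "\<lambda>j. inverse (\<gamma> j)"] by simp
    moreover have "Suc (n - 1) = n" "(- 1 / 2 :: real) ^ n = - (1 / 2) * (- 1 / 2) ^ (n - 1)"
      using m(4) by (auto simp flip: power_Suc)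
    ultimately show "fps_nth (f s m) n J - fps_nth (g s m) n J =
        (- 1 / 2) ^ n * (inverse (\<gamma> (M + 1)) - inverse (\<gamma>' (M + 1))) *
        (\<Prod>j=1..M. inverse (\<gamma> j)) * (\<Prod>j=m..M. inverse (\<gamma> j)) * (transport s ^^ n) (rho s) J"
      using fix_eq[of s m n] J by (simp add: mult_ac)
  qed
qed

text \<open>The first harmonic reaches the rate through one more transport, after the \<open>2 * M + 1\<close> steps up and down
the hierarchy; this closes the count of \<open>2 * M + 2\<close> derivatives and \<open>2 * M + 1\<close> factors \<open>- 1 / 2\<close>.\<close>
lemma first_difference_rate:
  assumes f: "slaved_fixpoint \<gamma> f" and g: "slaved_fixpoint \<gamma>' g"
    and eq: "\<forall>l\<in>{1..M}. \<gamma> l = \<gamma>' l" and J: "J \<in> jets_over \<Omega>"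
  shows "fps_nth (closed_rate v Dt f s) (2 * M) J - fps_nth (closed_rate v Dt g s) (2 * M) J =
    (inverse (\<gamma> (M + 1)) - inverse (\<gamma>' (M + 1))) / (2 ^ (2 * M + 1) * (\<Prod>j=1..M. (\<gamma> j)\<^sup>2)) *
      (transport s ^^ (2 * M + 2)) (rho s) J"
proof -
  let ?c = "(- 1 / 2) ^ (2 * M + 1) * (inverse (\<gamma> (M + 1)) - inverse (\<gamma>' (M + 1))) *
      (\<Prod>j=1..M. inverse (\<gamma> j)) * (\<Prod>j=1..M. inverse (\<gamma> j))"
  have diff: "differential_function \<Omega> (fps_nth (f s m) n)" "differential_function \<Omega> (fps_nth (g s m) n)" for s m n
    using f g unfolding slaved_fixpoint_def by blast+
  note agree = slaved_fixpoint_agree_below[OF f g eq]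
  have "fps_nth (closed_rate v Dt f s) (2 * M) J - fps_nth (closed_rate v Dt g s) (2 * M) J =
      - transport s (\<lambda>J. fps_nth (f s 1) (Suc (2 * M)) J - fps_nth (g s 1) (Suc (2 * M)) J) J"
    unfolding transport_def
    by (rule closed_rate_diff_top[where f = f and g = g, OF diff _ _ J]) (rule agree, simp)+
  also have "transport s (\<lambda>J. fps_nth (f s 1) (Suc (2 * M)) J - fps_nth (g s 1) (Suc (2 * M)) J) J =
      ?c * (transport s ^^ Suc (2 * M + 1)) (rho s) J"
    by (rule transport_scaled_funpow[OF _ J])
      (use first_difference_moment[OF f g eq, of M s] in \<open>simp add: mult_2\<close>)
  also have "- (?c * (transport s ^^ Suc (2 * M + 1)) (rho s) J) =
      (inverse (\<gamma> (M + 1)) - inverse (\<gamma>' (M + 1))) / (2 ^ (2 * M + 1) * (\<Prod>j=1..M. (\<gamma> j)\<^sup>2)) *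
      (transport s ^^ (2 * M + 2)) (rho s) J"
  proof -
    have pow: "(- 1 / 2 :: real) ^ (2 * M + 1) = - (1 / 2 ^ (2 * M + 1))"
      by (simp add: power_divide)
    have sq: "(\<Prod>j=1..M. (\<gamma> j)\<^sup>2) = (\<Prod>j=1..M. \<gamma> j) * (\<Prod>j=1..M. \<gamma> j)"
      by (simp add: power2_eq_square prod.distrib)
    have inv: "(\<Prod>j=1..M. inverse (\<gamma> j)) = inverse (\<Prod>j=1..M. \<gamma> j)"
      by (simp add: prod_inversef[symmetric] o_def)
    have index: "Suc (2 * M + 1) = 2 * M + 2"
      by simp
    have collect: "- (- (1 / a) * d * inverse p * inverse p * t) = d / (a * (p * p)) * t" for a d p t :: real
      by (simp add: divide_inverse)
    show ?thesis
      unfolding pow sq inv index by (rule collect)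
  qed
  finally show ?thesis .
qed

end

theorem theoremS6:
  fixes \<Omega> :: "('s::finite \<Rightarrow> real) set"
    and V :: "'s \<Rightarrow> ('s \<Rightarrow> real) \<Rightarrow> real"
    and v :: "'s \<Rightarrow> nat \<Rightarrow> 's jet \<Rightarrow> real"
    and Dt :: real
  assumes "open \<Omega>"
    and "\<And>s a. differential_function \<Omega> (v s a)"
    and "\<And>s J. J \<in> jets_over \<Omega> \<Longrightarrow> v s 0 J = V s (densities J)"
  shows
    "(\<forall>\<gamma>. (\<forall>m\<ge>1. \<gamma> m > 0) \<longrightarrow>
        (\<exists>f P. slaved_expansion \<Omega> v Dt \<gamma> f P \<and>
          (\<forall>f' P'. slaved_expansion \<Omega> v Dt \<gamma> f' P' \<longrightarrow>
             (\<forall>s m. series_eq_on \<Omega> (f s m) (f' s m)) \<and> (\<forall>s. series_eq_on \<Omega> (P s) (P' s))))) \<and>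
     (\<forall>\<gamma> f P. (\<forall>m\<ge>1. \<gamma> m > 0) \<and> slaved_expansion \<Omega> v Dt \<gamma> f P \<longrightarrow>
        (\<forall>s m n. \<forall>J\<in>jets_over \<Omega>.
           m \<ge> 1 \<and> \<not> (n \<ge> m \<and> even (n - m)) \<longrightarrow> fps_nth (f s m) n J = 0) \<and>
        (\<forall>s n. \<forall>J\<in>jets_over \<Omega>. odd n \<longrightarrow> fps_nth (P s) n J = 0)) \<and>
     (\<forall>\<gamma> \<gamma>' f f' P P'. (\<forall>m\<ge>1. \<gamma> m > 0) \<and> (\<forall>m\<ge>1. \<gamma>' m > 0) \<and>
        slaved_expansion \<Omega> v Dt \<gamma> f P \<and> slaved_expansion \<Omega> v Dt \<gamma>' f' P' \<longrightarrow>
        (\<forall>s m n. m \<ge> 1 \<and> n \<ge> m \<and> even (n - m) \<and> (\<forall>l\<in>{1..(n + m) div 2}. \<gamma> l = \<gamma>' l) \<longrightarrow>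
           (\<forall>J\<in>jets_over \<Omega>. fps_nth (f s m) n J = fps_nth (f' s m) n J)) \<and>
        (\<forall>s j. j \<ge> 1 \<and> (\<forall>l\<in>{1..j}. \<gamma> l = \<gamma>' l) \<longrightarrow>
           (\<forall>J\<in>jets_over \<Omega>. fps_nth (P s) (2 * j - 2) J = fps_nth (P' s) (2 * j - 2) J))) \<and>
     (\<forall>M \<gamma>p \<gamma>m f\<^sub>p f\<^sub>m P\<^sub>p P\<^sub>m. (\<forall>m\<ge>1. \<gamma>p m > 0) \<and> (\<forall>m\<ge>1. \<gamma>m m > 0) \<and>
        (\<forall>m\<in>{1..M}. \<gamma>p m = \<gamma>m m) \<and>
        slaved_expansion \<Omega> v Dt \<gamma>p f\<^sub>p P\<^sub>p \<and> slaved_expansion \<Omega> v Dt \<gamma>m f\<^sub>m P\<^sub>m \<longrightarrow>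
        (\<forall>s. \<forall>J\<in>jets_over \<Omega>.
           (\<forall>j\<in>{1..M}. fps_nth (P\<^sub>p s) (2 * j - 2) J = fps_nth (P\<^sub>m s) (2 * j - 2) J) \<and>
           fps_nth (P\<^sub>p s) (2 * M + 2 - 2) J - fps_nth (P\<^sub>m s) (2 * M + 2 - 2) J =
             (inverse (\<gamma>p (M + 1)) - inverse (\<gamma>m (M + 1)))
               / (2 ^ (2 * M + 1) * (\<Prod>j=1..M. (\<gamma>p j)\<^sup>2))
               * (flux_deriv V s ^^ (2 * M + 2)) (rho s) J))"
proof -
  interpret angular_hierarchy \<Omega> v Dt
    by unfold_locales (rule assms)+
  note fixpoint = slaved_expansion_fixpoint(1) and rate = slaved_expansion_fixpoint(2)
  have flux_eq: "(flux_deriv V s ^^ n) (rho s) J = (transport s ^^ n) (rho s) J"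
    if "J \<in> jets_over \<Omega>" for s n J
    using that
  proof (induction n arbitrary: J)
    case (Suc n)
    then show ?case
      by (auto simp: flux_deriv_def transport_def assms(3) intro!: total_deriv_cong)
  qed simp
  have existence_uniqueness: "\<exists>f P. slaved_expansion \<Omega> v Dt \<gamma> f P \<and>
      (\<forall>f' P'. slaved_expansion \<Omega> v Dt \<gamma> f' P' \<longrightarrow>
        (\<forall>s m. series_eq_on \<Omega> (f s m) (f' s m)) \<and> (\<forall>s. series_eq_on \<Omega> (P s) (P' s)))"
    if pos: "\<forall>m\<ge>1. \<gamma> m > 0" for \<gamma>
  proof -
    obtain f where f: "slaved_fixpoint \<gamma> f" and f0: "\<And>s. f s 0 = fps_const (rho s)"
      using slaved_fixpoint_exists by blast
    have "series_eq_on \<Omega> (f s m) (f' s m) \<and> series_eq_on \<Omega> (closed_rate v Dt f s) (P' s)"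
      if sl: "slaved_expansion \<Omega> v Dt \<gamma> f' P'" for f' P' s m
    proof -
      have eq: "fps_nth (f u l) n \<doteq> fps_nth (f' u l) n" for u l n
        by (rule slaved_fixpoint_unique[OF f fixpoint[OF pos sl]])
      then have "fps_nth (closed_rate v Dt f s) n \<doteq> fps_nth (closed_rate v Dt f' s) n" for n
        by (intro closed_rate_cong) auto
      then show ?thesis
        using eq rate[OF pos sl] by (simp add: series_eq_on_def)
    qed
    then show ?thesis
      using fixpoint_slaved_expansion[OF pos f f0] by blast
  qed
  have order_structure: "(\<forall>s m n. \<forall>J\<in>jets_over \<Omega>.
        m \<ge> 1 \<and> \<not> (n \<ge> m \<and> even (n - m)) \<longrightarrow> fps_nth (f s m) n J = 0) \<and>
      (\<forall>s n. \<forall>J\<in>jets_over \<Omega>. odd n \<longrightarrow> fps_nth (P s) n J = 0)"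
    if pos: "\<forall>m\<ge>1. \<gamma> m > 0" and sl: "slaved_expansion \<Omega> v Dt \<gamma> f P" for \<gamma> f P
  proof -
    note parity = slaved_fixpoint_parity[OF fixpoint[OF pos sl]]
    have "fps_nth (f s m) n \<doteq> 0" if "\<not> (n \<ge> m \<and> even (n - m))" for s m n
      by (rule parity) (use that in auto)
    moreover have "fps_nth (closed_rate v Dt f s) n \<doteq> 0" if "odd n" for s n
      by (rule closed_rate_parity[OF parity parity that]) (use that in auto)
    ultimately show ?thesis
      using rate[OF pos sl] by simp
  qed
  have dependence: "fps_nth (f s m) n \<doteq> fps_nth (f' s m) n"
    if "\<forall>m\<ge>1. \<gamma> m > 0" "\<forall>m\<ge>1. \<gamma>' m > 0" "slaved_expansion \<Omega> v Dt \<gamma> f P"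
      "slaved_expansion \<Omega> v Dt \<gamma>' f' P'" "\<forall>l\<in>{1..(n + m) div 2}. \<gamma> l = \<gamma>' l"
    for \<gamma> \<gamma>' f f' P P' s m n
    by (rule slaved_fixpoint_rate_dependence[OF fixpoint[OF that(1,3)] fixpoint[OF that(2,4)] that(5)])
  have rate_dependence: "fps_nth (P s) (2 * j - 2) \<doteq> fps_nth (P' s) (2 * j - 2)"
    if "\<forall>m\<ge>1. \<gamma> m > 0" "\<forall>m\<ge>1. \<gamma>' m > 0" "slaved_expansion \<Omega> v Dt \<gamma> f P"
      "slaved_expansion \<Omega> v Dt \<gamma>' f' P'" "j \<ge> 1" "\<forall>l\<in>{1..j}. \<gamma> l = \<gamma>' l"
    for \<gamma> \<gamma>' f f' P P' s j
  proof -
    \<comment> \<open>The subtraction does not truncate because \<open>j \<ge> 1\<close>.\<close>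
    have half: "(2 * j - 2 + 2) div 2 = j"
      using that(5) by simp
    have "fps_nth (closed_rate v Dt f s) (2 * j - 2) \<doteq> fps_nth (closed_rate v Dt f' s) (2 * j - 2)"
      by (rule closed_rate_dependence[OF fixpoint[OF that(1,3)] fixpoint[OF that(2,4)]])
        (unfold half, rule that(6))
    then show ?thesis
      using rate[OF that(1,3)] rate[OF that(2,4)] by simp
  qed
  have agreement: "fps_nth (P s) (2 * j - 2) J = fps_nth (P' s) (2 * j - 2) J"
    if "\<forall>m\<ge>1. \<gamma> m > 0" "\<forall>m\<ge>1. \<gamma>' m > 0" "slaved_expansion \<Omega> v Dt \<gamma> f P"
      "slaved_expansion \<Omega> v Dt \<gamma>' f' P'" "\<forall>l\<in>{1..M}. \<gamma> l = \<gamma>' l" "j \<in> {1..M}" "J \<in> jets_over \<Omega>"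
    for \<gamma> \<gamma>' f f' P P' s M j J
  proof -
    have "j \<ge> 1" "\<forall>l\<in>{1..j}. \<gamma> l = \<gamma>' l"
      using that(5,6) by auto
    from rate_dependence[OF that(1-4) this] that(7) show ?thesis by blast
  qed
  have first_difference: "fps_nth (P s) (2 * M + 2 - 2) J - fps_nth (P' s) (2 * M + 2 - 2) J =
      (inverse (\<gamma> (M + 1)) - inverse (\<gamma>' (M + 1))) / (2 ^ (2 * M + 1) * (\<Prod>j=1..M. (\<gamma> j)\<^sup>2))
        * (flux_deriv V s ^^ (2 * M + 2)) (rho s) J"
    if "\<forall>m\<ge>1. \<gamma> m > 0" "\<forall>m\<ge>1. \<gamma>' m > 0" "slaved_expansion \<Omega> v Dt \<gamma> f P"
      "slaved_expansion \<Omega> v Dt \<gamma>' f' P'" "\<forall>l\<in>{1..M}. \<gamma> l = \<gamma>' l" "J \<in> jets_over \<Omega>"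
    for \<gamma> \<gamma>' f f' P P' s M J
    using first_difference_rate[OF fixpoint[OF that(1,3)] fixpoint[OF that(2,4)] that(5,6), of s]
      rate[OF that(1,3), of s "2 * M"] rate[OF that(2,4), of s "2 * M"] that(6)
    by (simp only: flux_eq[OF that(6)] add_diff_cancel_right') 
  show ?thesis
    apply (intro conjI)
    subgoal using existence_uniqueness by blast
    subgoal using order_structure by blast
    subgoal
      apply (intro allI impI conjI; elim conjE)
      subgoal by (rule dependence, assumption+)
      subgoal by (rule rate_dependence, assumption+)
      done
    subgoal
      apply (intro allI impI ballI conjI; elim conjE)
      subgoal by (rule agreement, assumption+)
      subgoal by (rule first_difference, assumption+)
      done
    done
qed

end
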